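(* Let $g>1$ be an integer, and let $f(X)\in\mathbb{Z}[X]$ be a polynomial of degree $\deg f\ge 3$ with a positive leading coefficient and no multiple roots in its splitting field. Put $u(n)=f(g^n)$ for $n\ge 1$. Let $\alpha>0$ be a real number for which $$ \left|\left\{\ell\le z:\ \ell \text{ is prime and } P^+(\ell-1)\ge \ell^{\alpha}\right\}\right|\gg \frac{z}{\log z} $$ for all sufficiently large $z$, where the implied constant depends only on $\alpha$. Then, uniformly for all $M,N,s\in\mathbb{Z}$ with $N\ge 2$ and $s$ squarefree, $$ Q_u(M,N;s)\ll N^{\beta}(\log N)^{\gamma},\qquad \beta=(2\alpha)^{-1},\quad \gamma=2-\alpha^{-1}, $$ where the implied constant depends only on $f$, $g$ and $\alpha$.
   Context: $P^+(k)$ denotes the largest prime divisor of an integer $k\ge 2$. For $M,N,s\in\mathbb{Z}$ with $N\ge1$ and $s$ squarefree, $Q_u(M,N;s)$ denotes the number of integers $n\in[M+1,M+N]$ (with $n\ge 1$, where $u(n)$ is defined) for which $\mathbb{Q}(\sqrt{u(n)})=\mathbb{Q}(\sqrt{s})$. The notation $A\ll B$ (equivalently $B\gg A$) means $|A|\le cB$ for some constant $c>0$ (the implied constant). *)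

theory Defs
  imports
    Complex_Main
    "HOL-Algebra.Generated_Fields"
    "HOL-Algebra.Algebraic_Closure_Type"
    "HOL-Library.Landau_Symbols"
    "HOL-Computational_Algebra.Computational_Algebra"
begin

text \<open>
  Largest prime divisor; the value at arguments below 2 is the usual convention \<open>P\<^sup>+(1) = 1\<close>.
\<close>
definition largest_prime_divisor :: "nat \<Rightarrow> nat" where
  "largest_prime_divisor k = (if k \<ge> 2 then Max {p. Factorial_Ring.prime p \<and> p dvd k} else 1)"

text \<open>
  The field \<open>\<rat>(\<surd>a)\<close> as a subfield of the complex numbers. Negative \<open>a\<close> is allowed; the result
  does not depend on which of the two square roots is adjoined.
\<close>
definition rat_adjoin_sqrt :: "int \<Rightarrow> complex set" where
  "rat_adjoin_sqrt a =
     generate_field (ring_of_type_algebra :: complex ring) (\<rat> \<union> {csqrt (of_int a)})"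

definition Q_count :: "(nat \<Rightarrow> int) \<Rightarrow> int \<Rightarrow> int \<Rightarrow> int \<Rightarrow> nat" where
  "Q_count u M N s =
     card {n::nat. n \<ge> 1 \<and> int n \<in> {M + 1..M + N} \<and>
                   rat_adjoin_sqrt (u n) = rat_adjoin_sqrt s}"

end

theory Submission
  imports Defs "HOL-Number_Theory.Number_Theory" "HOL-Real_Asymp.Real_Asymp"
begin

text \<open>
  If \<open>\<rat>(\<surd>u(n)) = \<rat>(\<surd>s)\<close> then \<open>s u(n)\<close> is a square, so for every odd prime \<open>p\<close> the residue of
  \<open>u(n)\<close> vanishes or has the same quadratic character as \<open>s\<close>. Let \<open>p = m r + 1\<close> with \<open>r\<close> a prime of
  size at least \<open>p\<^bsup>\<alpha>\<^esup>\<close>, where \<open>\<alpha> > 1/2\<close> (for \<open>\<alpha> \<le> 1/2\<close> the claim is trivial). Shifting \<open>n\<close> by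
  multiples of \<open>m\<close> moves \<open>g\<^bsup>n\<^esup>\<close> through a coset of the subgroup of order \<open>r\<close> modulo \<open>p\<close>, and by
  Stepanov's method at most three quarters of such a coset satisfy the condition on \<open>p\<close>.
  Subtracting the coset average from the indicator function of the condition thus leaves a function
  \<open>H\<^bsub>p\<^esub>\<close> with values at least \<open>1/4\<close> at all \<open>n\<close> that are counted. The products \<open>H\<^bsub>p\<^esub> H\<^bsub>q\<^esub>\<close> have mean
  value exactly \<open>0\<close> over a period as soon as \<open>r\<^bsub>p\<^esub>\<close> does not divide \<open>q - 1\<close>. Averaging \<open>(\<Sum> H\<^bsub>p\<^esub>)\<^sup>2\<close>
  with an iterated box kernel and taking the primes up to \<open>N\<^bsup>\<tau>\<^esup>\<close>, \<open>\<tau> < 1/2\<close>, gives a bound of order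
  \<open>N\<^bsup>1 - \<alpha>\<tau>\<^esup>\<close> up to logarithms, which for \<open>\<tau>\<close> close to \<open>1/2\<close> is smaller than \<open>N\<^bsup>\<beta>\<^esup>\<close> by a power of \<open>N\<close>,
  because \<open>1 - \<alpha>/2 < 1/(2\<alpha>)\<close>.
\<close>

section \<open>Integer polynomials modulo a prime\<close>

lemma prime_dvd_poly_mult_iff:
  fixes p :: int
  assumes "prime p"
  shows "[:p:] dvd A * B \<longleftrightarrow> [:p:] dvd A \<or> [:p:] dvd B"
  using lift_prime_elem_poly[OF prime_imp_prime_elem[OF assms]] by (rule prime_elem_dvd_mult_iff)

lemma prime_dvd_poly_power_iff:
  fixes p :: int
  assumes "prime p"
  shows "[:p:] dvd A ^ n \<longleftrightarrow> [:p:] dvd A \<and> n > 0"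
  using assms by (induction n) (auto simp: prime_dvd_poly_mult_iff is_unit_const_poly_iff)

lemma poly_dvd_of_const_poly_dvd:
  fixes p :: int
  assumes "[:p:] dvd A"
  shows "p dvd poly A x"
  using assms by (auto elim!: dvdE)

text \<open>Leading terms divisible by \<open>p\<close> are removed one at a time; the descent ends
  because \<open>A\<close> is nonzero modulo \<open>p\<close>. The degree of \<open>B\<close> is
  then the true degree over the field with \<open>p\<close> elements, so degree arguments over that
  field can be run on integer polynomials.\<close>

lemma poly_mod_reduced:
  fixes p :: int
  assumes "\<not> [:p:] dvd A"
  obtains B where "[:p:] dvd A - B" "\<not> p dvd lead_coeff B" "degree B \<le> degree A"
  using assms
proof (induction "degree A" arbitrary: A thesis rule: less_induct)
  case less
  show thesis
  proof (cases "p dvd lead_coeff A")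
    case False
    then show thesis using less.prems(1)[of A] by simp
  next
    case True
    define A' where "A' = A - monom (lead_coeff A) (degree A)"
    have dv: "[:p:] dvd A - A'" using True
      by (simp add: A'_def const_poly_dvd_iff)
    have nz: "\<not> [:p:] dvd A'" using dv less.prems(2)
      by (metis diff_add_cancel dvd_add)
    have pos: "degree A \<noteq> 0"
    proof
      assume "degree A = 0"
      then have "A' = 0" by (auto simp: A'_def poly_eq_iff coeff_eq_0)
      then show False using nz by simp
    qed
    have "degree A' < degree A"
      using pos by (intro degree_lessI) (auto simp: A'_def coeff_eq_0)
    then obtain B where "[:p:] dvd A' - B" "\<not> p dvd lead_coeff B" "degree B \<le> degree A'"
      using less.hyps nz by metis
    moreover have "A - B = (A - A') + (A' - B)" by simp
    ultimately show thesis using less.prems(1)[of B] dv \<open>degree A' < degree A\<close>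
      by (metis dvd_add le_trans less_imp_le)
  qed
qed

lemma degree_le_of_lead_coeff_not_dvd:
  fixes p :: int
  assumes "[:p:] dvd A - B" "\<not> p dvd lead_coeff B"
  shows "degree B \<le> degree A"
proof (rule ccontr)
  assume "\<not> degree B \<le> degree A"
  then have "coeff A (degree B) = 0" by (simp add: coeff_eq_0)
  then show False using assms by (auto simp: const_poly_dvd_iff dest: spec[of _ "degree B"])
qed

section \<open>Zeros with multiplicity modulo a prime\<close>

lemma linear_dvd_minus_poly: "[:-x, 1:] dvd Q - [:poly Q x:]" for x :: "'a::comm_ring_1"
  by (metis (no_types) dvd_triv_left add_diff_cancel_right' synthetic_div_correct' )

lemma root_imp_linear_factor_mod:
  fixes p x :: int
  assumes "p dvd poly Q x"
  obtains Q1 where "[:p:] dvd Q - [:-x, 1:] * Q1"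
proof -
  obtain Q1 where "Q - [:poly Q x:] = [:-x, 1:] * Q1" using linear_dvd_minus_poly by blast
  then have "Q - [:-x, 1:] * Q1 = [:poly Q x:]" by (simp add: algebra_simps)
  then show thesis using that[of Q1] assms by simp
qed

text \<open>Stands in for the coprimality of \<open>W\<close> and \<open>X - x\<close> over the
  field with \<open>p\<close> elements: as \<open>W\<close> does not vanish at \<open>x\<close>,
  \<open>Q\<close> must, and one factor \<open>X - x\<close>, which is nonzero modulo
  \<open>p\<close>, is cancelled at each step.\<close>

lemma linear_power_cancel_mod:
  fixes p x :: int
  assumes p: "prime p" and W: "\<not> p dvd poly W x"
    and eq: "[:p:] dvd W * Q - [:-x, 1:] ^ l * Q'"
  shows "\<exists>Q1. [:p:] dvd Q - [:-x, 1:] ^ l * Q1"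
  using eq
proof (induction l arbitrary: Q Q')
  case 0
  show ?case by (intro exI[of _ Q]) simp
next
  case (Suc l)
  have "p dvd poly (W * Q - [:-x, 1:] ^ Suc l * Q') x"
    using Suc.prems poly_dvd_of_const_poly_dvd by blast
  then have "p dvd poly W x * poly Q x" by simp
  then have "p dvd poly Q x" using W p by (simp add: prime_dvd_mult_iff)
  then obtain Q1 where Q1: "[:p:] dvd Q - [:-x, 1:] * Q1" by (rule root_imp_linear_factor_mod)
  have "[:p:] dvd (W * Q - [:-x, 1:] ^ Suc l * Q') - W * (Q - [:-x, 1:] * Q1)"
    using Suc.prems Q1 by (meson dvd_diff dvd_mult)
  also have "(W * Q - [:-x, 1:] ^ Suc l * Q') - W * (Q - [:-x, 1:] * Q1)
     = [:-x, 1:] * (W * Q1 - [:-x, 1:] ^ l * Q')"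
    by (simp add: algebra_simps)
  finally have "[:p:] dvd W * Q1 - [:-x, 1:] ^ l * Q'"
  proof -
    assume "[:p:] dvd [:-x, 1:] * (W * Q1 - [:-x, 1:] ^ l * Q')"
    moreover have "\<not> [:p:] dvd [:-x, 1:]"
    proof
      assume "[:p:] dvd [:-x, 1:]"
      then have "p dvd coeff [:-x, 1:] 1" by (simp only: const_poly_dvd_iff)
      then show False using p not_prime_unit[of p] by simp
    qed
    ultimately show ?thesis using p prime_dvd_poly_mult_iff by blast
  qed
  then obtain Q2 where "[:p:] dvd Q1 - [:-x, 1:] ^ l * Q2" using Suc.IH by blast
  then have "[:p:] dvd (Q - [:-x, 1:] * Q1) + [:-x, 1:] * (Q1 - [:-x, 1:] ^ l * Q2)"
    using Q1 by (meson dvd_add dvd_mult)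
  also have "(Q - [:-x, 1:] * Q1) + [:-x, 1:] * (Q1 - [:-x, 1:] ^ l * Q2) = Q - [:-x, 1:] ^ Suc l * Q2"
    by (simp add: algebra_simps)
  finally show ?case by blast
qed

lemma product_linear_powers_mod:
  fixes p :: int
  assumes p: "prime p" and "finite Z"
    and dist: "\<And>x y. x \<in> Z \<Longrightarrow> y \<in> Z \<Longrightarrow> p dvd x - y \<Longrightarrow> x = y"
    and mult: "\<And>x. x \<in> Z \<Longrightarrow> \<exists>Q. [:p:] dvd P - [:-x, 1:] ^ l * Q"
  shows "\<exists>Q. [:p:] dvd P - (\<Prod>x\<in>Z. [:-x, 1:] ^ l) * Q"
  using \<open>finite Z\<close> dist mult
proof (induction Z)
  case empty
  show ?case by (intro exI[of _ P]) simp
next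
  case (insert y Z)
  define W where "W = (\<Prod>x\<in>Z. [:-x, 1:] ^ l)"
  have "\<exists>Q. [:p:] dvd P - W * Q"
    unfolding W_def by (rule insert.IH) (use insert.prems in blast)+
  then obtain Q where Q: "[:p:] dvd P - W * Q" by blast
  obtain Q' where Q': "[:p:] dvd P - [:-y, 1:] ^ l * Q'" using insert.prems(2) by blast
  have "[:p:] dvd (P - [:-y, 1:] ^ l * Q') - (P - W * Q)" using Q Q' by (rule dvd_diff[rotated])
  then have 1: "[:p:] dvd W * Q - [:-y, 1:] ^ l * Q'" by simp
  have 2: "\<not> p dvd poly W y"
  proof
    assume "p dvd poly W y"
    then have "p dvd (\<Prod>x\<in>Z. (y - x) ^ l)" by (simp add: W_def poly_prod)
    then obtain x where "x \<in> Z" "p dvd (y - x) ^ l"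
      using p insert.hyps(1) by (auto simp: prime_dvd_prod_iff)
    then have "p dvd y - x" using p prime_dvd_power by blast
    then have "y = x" using insert.prems(1) \<open>x \<in> Z\<close> by blast
    then show False using \<open>x \<in> Z\<close> insert.hyps(2) by blast
  qed
  obtain Q1 where Q1: "[:p:] dvd Q - [:-y, 1:] ^ l * Q1"
    using linear_power_cancel_mod[OF p 2 1] by blast
  have "[:p:] dvd (P - W * Q) + W * (Q - [:-y, 1:] ^ l * Q1)"
    using Q Q1 by (meson dvd_add dvd_mult)
  also have "(P - W * Q) + W * (Q - [:-y, 1:] ^ l * Q1) = P - ([:-y, 1:] ^ l * W) * Q1"
    by (simp add: algebra_simps)
  finally show ?case using insert.hyps by (auto simp: W_def)
qed

text \<open>The product of the \<open>l\<close>-th powers is monic of degree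
  \<open>l * card Z\<close>; once the cofactor is reduced modulo \<open>p\<close>, degrees add
  without loss.\<close>

lemma multiple_roots_mod_bound:
  fixes p :: int
  assumes p: "prime p" and "finite Z"
    and dist: "\<And>x y. x \<in> Z \<Longrightarrow> y \<in> Z \<Longrightarrow> p dvd x - y \<Longrightarrow> x = y"
    and mult: "\<And>x. x \<in> Z \<Longrightarrow> \<exists>Q. [:p:] dvd P - [:-x, 1:] ^ l * Q"
    and P: "\<not> [:p:] dvd P"
  shows "l * card Z \<le> degree P"
proof -
  define W where "W = (\<Prod>x\<in>Z. [:-x, 1:] ^ l)"
  have "lead_coeff W = (\<Prod>x\<in>Z. lead_coeff ([:-x, 1:] ^ l))"
    unfolding W_def by (rule lead_coeff_prod)
  also have "\<dots> = 1" by (simp only: lead_coeff_power) simp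
  finally have W: "lead_coeff W = 1" "degree W = l * card Z"
    by (auto simp: W_def degree_prod_eq_sum_degree degree_power_eq)
  obtain Q where Q: "[:p:] dvd P - W * Q"
    using product_linear_powers_mod[OF p \<open>finite Z\<close> dist mult] unfolding W_def by blast
  have "\<not> [:p:] dvd Q" using Q P by (metis diff_add_cancel dvd_add dvd_mult)
  then obtain B where B: "[:p:] dvd Q - B" "\<not> p dvd lead_coeff B"
    by (rule poly_mod_reduced)
  have "P - W * B = (P - W * Q) + W * (Q - B)" by (simp add: algebra_simps)
  then have "[:p:] dvd P - W * B" using Q B by (metis dvd_add dvd_mult)
  moreover have "\<not> p dvd lead_coeff (W * B)" using B(2) W(1) by (simp add: lead_coeff_mult)
  ultimately have "degree (W * B) \<le> degree P" by (rule degree_le_of_lead_coeff_not_dvd)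
  moreover have "W \<noteq> 0" "B \<noteq> 0" using W(1) B(2) by auto
  ultimately show ?thesis using W(2) by (simp add: degree_mult_eq)
qed

section \<open>Derivations that detect multiplicity\<close>

text \<open>Each application of \<open>w d/dX\<close> lowers the exponent of \<open>X - x\<close> by
  one and brings down that exponent and a factor \<open>w\<close>; the summand that differentiates
  the cofactor keeps its factor \<open>X - x\<close> and dies at \<open>x\<close>. For
  \<open>k = l\<close> the product is \<open>l!\<close>.\<close>

lemma derivation_power_linear:
  fixes w B :: "int poly"
  assumes "k \<le> l"
  shows "\<exists>B'. ((\<lambda>P. w * pderiv P) ^^ k) ([:-x, 1:] ^ l * B) = [:-x, 1:] ^ (l - k) * B'
    \<and> poly B' x = (\<Prod>i<k. int (l - i)) * poly w x ^ k * poly B x"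
  using assms
proof (induction k)
  case 0
  show ?case by (intro exI[of _ B]) simp
next
  case (Suc k)
  then obtain B' where B': "((\<lambda>P. w * pderiv P) ^^ k) ([:-x, 1:] ^ l * B) = [:-x, 1:] ^ (l - k) * B'"
    "poly B' x = (\<Prod>i<k. int (l - i)) * poly w x ^ k * poly B x" by auto
  obtain n where n: "l - k = Suc n" using Suc.prems by (cases "l - k") auto
  define B'' where "B'' = w * (smult (int (Suc n)) B' + [:-x, 1:] * pderiv B')"
  have pl: "pderiv [:-x, 1:] = 1" by (simp add: pderiv_pCons)
  have "w * pderiv ([:-x, 1:] ^ Suc n * B') = [:-x, 1:] ^ n * B''"
    unfolding pderiv_mult pderiv_power_Suc pl B''_def
    by (simp add: algebra_simps)
  moreover have "poly B'' x = (\<Prod>i<Suc k. int (l - i)) * poly w x ^ Suc k * poly B x"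
  proof -
    have "(\<Prod>i<Suc k. int (l - i)) = (\<Prod>i<k. int (l - i)) * int (Suc n)"
      using n by (simp only: prod.lessThan_Suc)
    moreover have "poly B'' x = poly w x * (int (Suc n) * poly B' x)"
      by (simp add: B''_def)
    ultimately show ?thesis by (simp only: B'(2) power_Suc mult_ac)
  qed
  moreover have "l - Suc k = n" using n by simp
  ultimately show ?case using B'(1) n by auto
qed

text \<open>Once \<open>(X - x)^l\<close> divides \<open>P\<close> modulo \<open>p\<close> with
  cofactor \<open>Q\<close>, the \<open>l\<close>-th derivation takes the value
  \<open>l! w(x)^l Q(x)\<close> at \<open>x\<close>. The bound on \<open>l\<close> keeps the
  factorial prime to \<open>p\<close>, so its vanishing forces another factor \<open>X - x\<close>
  out of \<open>Q\<close>.\<close>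

lemma multiple_root_mod_by_derivation:
  fixes p x :: int and w P :: "int poly"
  assumes p: "prime p" and w: "\<not> p dvd poly w x" and "int l \<le> p"
    and van: "\<And>k. k < l \<Longrightarrow> p dvd poly (((\<lambda>P. w * pderiv P) ^^ k) P) x"
  shows "\<exists>Q. [:p:] dvd P - [:-x, 1:] ^ l * Q"
  using \<open>int l \<le> p\<close> van
proof (induction l)
  case 0
  show ?case by (intro exI[of _ P]) simp
next
  case (Suc l)
  then obtain Q where Q: "[:p:] dvd P - [:-x, 1:] ^ l * Q" by auto
  \<comment> \<open>The derivation respects congruences modulo \<open>p\<close>, so \<open>P\<close>
    may be replaced by the multiple of \<open>(X - x)^l\<close>.\<close>
  have inv: "[:p:] dvd ((\<lambda>P. w * pderiv P) ^^ k) A - ((\<lambda>P. w * pderiv P) ^^ k) B"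
    if "[:p:] dvd A - B" for A B k
  proof (induction k)
    case 0
    show ?case using that by simp
  next
    case (Suc k)
    then obtain E where E: "((\<lambda>P. w * pderiv P) ^^ k) A - ((\<lambda>P. w * pderiv P) ^^ k) B = [:p:] * E" by auto
    have "((\<lambda>P. w * pderiv P) ^^ Suc k) A - ((\<lambda>P. w * pderiv P) ^^ Suc k) B = w * pderiv ([:p:] * E)"
      unfolding E[symmetric] pderiv_diff by (simp add: right_diff_distrib)
    also have "\<dots> = [:p:] * (w * pderiv E)" by (simp add: pderiv_smult)
    finally show ?case by (rule dvdI)
  qed
  obtain B' where B': "((\<lambda>P. w * pderiv P) ^^ l) ([:-x, 1:] ^ l * Q) = B'"
    "poly B' x = (\<Prod>i<l. int (l - i)) * poly w x ^ l * poly Q x"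
    using derivation_power_linear[of l l w x Q] by auto
  have "p dvd poly (((\<lambda>P. w * pderiv P) ^^ l) P) x" using Suc.prems(2) by simp
  moreover have "p dvd poly (((\<lambda>P. w * pderiv P) ^^ l) P - B') x"
    using inv[OF Q, of l] unfolding B'(1) by (rule poly_dvd_of_const_poly_dvd)
  ultimately have "p dvd poly B' x"
    by (simp) (metis add_diff_cancel_left' diff_diff_eq2 dvd_diff)
  moreover have "\<not> p dvd (\<Prod>i<l. int (l - i))"
  proof
    assume "p dvd (\<Prod>i<l. int (l - i))"
    then obtain i where "i < l" "p dvd int (l - i)" using p by (auto simp: prime_dvd_prod_iff)
    then have "p \<le> int (l - i)" by (intro zdvd_imp_le) auto
    then show False using Suc.prems(1) by simp
  qed
  moreover have "\<not> p dvd poly w x ^ l" using p w prime_dvd_power by blast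
  ultimately have "p dvd poly Q x" using p by (simp add: B'(2) prime_dvd_mult_iff)
  then obtain Q1 where Q1: "[:p:] dvd Q - [:-x, 1:] * Q1" by (rule root_imp_linear_factor_mod)
  have "P - [:-x, 1:] ^ Suc l * Q1 = (P - [:-x, 1:] ^ l * Q) + [:-x, 1:] ^ l * (Q - [:-x, 1:] * Q1)"
    by (simp add: algebra_simps)
  then have "[:p:] dvd P - [:-x, 1:] ^ Suc l * Q1" using Q Q1 by (metis dvd_add dvd_mult)
  then show ?case by blast
qed

section \<open>Frobenius and square roots modulo a prime\<close>

lemma freshman_power:
  fixes a b :: "'a::comm_ring_1"
  assumes p: "prime p"
  shows "of_nat p dvd (a + b) ^ p - (a ^ p + b ^ p)"
proof -
  define t where "t k = of_nat (p choose k) * a ^ k * b ^ (p - k)" for k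
  have "1 < p" using p prime_gt_1_nat by blast
  then have "{..p} = insert 0 (insert p {1..<p})" by auto
  then have "(a + b) ^ p = t 0 + (t p + (\<Sum>k\<in>{1..<p}. t k))"
    using \<open>1 < p\<close> by (simp add: binomial_ring t_def)
  then have "(a + b) ^ p - (a ^ p + b ^ p) = (\<Sum>k\<in>{1..<p}. t k)"
    by (simp add: t_def)
  also have "of_nat p dvd \<dots>"
  proof (rule dvd_sum)
    fix k assume "k \<in> {1..<p}"
    then have "p dvd p choose k" using p by (intro dvd_choose_prime) auto
    then have "(of_nat p :: 'a) dvd of_nat (p choose k)" by (auto elim!: dvdE)
    then show "of_nat p dvd t k" by (simp add: t_def mult.assoc)
  qed
  finally show ?thesis .
qed

lemma fermat_theorem_int:
  fixes a :: int
  assumes p: "prime p" and a: "\<not> int p dvd a"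
  shows "[a ^ (p - 1) = 1] (mod int p)"
proof -
  define b where "b = nat (a mod int p)"
  have b: "int b = a mod int p" using prime_gt_0_nat[OF p] by (simp add: b_def)
  have "\<not> p dvd b"
  proof
    assume "p dvd b"
    then have "int p dvd a mod int p" unfolding b[symmetric] by simp
    then show False using a by (simp add: dvd_mod_iff)
  qed
  then have "[b ^ (p - 1) = 1] (mod p)" using p by (intro fermat_theorem)
  then have "[int b ^ (p - 1) = 1] (mod int p)" by (metis cong_int_iff of_nat_1 of_nat_power)
  moreover have "[a ^ (p - 1) = int b ^ (p - 1)] (mod int p)"
    by (rule cong_pow) (simp add: b cong_def)
  ultimately show ?thesis by (rule cong_trans[rotated])
qed

text \<open>Frobenius applied to \<open>f = c + X f1\<close>, with \<open>c^p = c\<close> modulo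
  \<open>p\<close>. It later turns \<open>f^p\<close> into the constant \<open>f(0)\<close> modulo a
  power of \<open>X\<close>.\<close>

lemma poly_power_prime_mod:
  fixes f :: "int poly"
  assumes p: "prime p"
  shows "\<exists>G. [:int p:] dvd f ^ p - [:poly f 0:] - monom 1 p * G"
proof -
  obtain c f1 where f: "f = pCons c f1" by (cases f)
  have f': "f = [:c:] + monom 1 1 * f1" by (simp add: f monom_altdef)
  have "of_nat p dvd f ^ p - ([:c:] ^ p + (monom 1 1 * f1) ^ p)"
    unfolding f' using p by (rule freshman_power)
  then have 1: "[:int p:] dvd f ^ p - ([:c ^ p:] + monom 1 p * f1 ^ p)"
    by (simp add: of_nat_poly power_mult_distrib monom_power poly_const_pow)
  have "[c ^ p = c] (mod int p)"
  proof (cases "int p dvd c")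
    case True
    then have "int p dvd c ^ p" using p by (meson dvd_power dvd_trans prime_gt_0_nat)
    then show ?thesis using True by (simp add: cong_iff_dvd_diff)
  next
    case False
    have "[c * c ^ (p - 1) = c * 1] (mod int p)"
      using p False by (intro cong_scalar_left fermat_theorem_int)
    moreover have "c * c ^ (p - 1) = c ^ p"
      using prime_gt_0_nat[OF p] by (cases p) auto
    ultimately show ?thesis by simp
  qed
  then have "[:int p:] dvd [:c ^ p:] - [:c:]" by (simp add: cong_iff_dvd_diff)
  with 1 have 1: "[:int p:] dvd (f ^ p - ([:c ^ p:] + monom 1 p * f1 ^ p)) + ([:c ^ p:] - [:c:])"
    by (rule dvd_add)
  then have "[:int p:] dvd f ^ p - [:poly f 0:] - monom 1 p * f1 ^ p"
  proof -
    have "(f ^ p - (A + D)) + (A - C) = f ^ p - C - D" for A C D by (simp add: algebra_simps)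
    moreover have "poly f 0 = c" by (simp add: f)
    ultimately show ?thesis using 1 by (simp only:)
  qed
  then show ?thesis by blast
qed

text \<open>The descent behind the irrationality of square roots: among the representations of
  \<open>\<surd>(f / c)\<close> as a fraction \<open>s / r\<close> modulo \<open>p\<close>, one of minimal denominator is a polynomial.\<close>

lemma square_root_integral_mod:
  fixes p c :: int
  assumes p: "prime p" and c: "\<not> p dvd c" and r: "\<not> [:p:] dvd r"
    and rs: "[:p:] dvd r ^ 2 * f - [:c:] * s ^ 2"
  obtains q k where "\<not> p dvd k" "[:p:] dvd [:k:] * f - [:c:] * q ^ 2"
proof -
  define Frac where "Frac r \<longleftrightarrow> \<not> [:p:] dvd r \<and> (\<exists>s. [:p:] dvd r ^ 2 * f - [:c:] * s ^ 2)" for r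
  have "Frac r" using r rs by (auto simp: Frac_def)
  from ex_has_least_nat[of Frac, OF this, of degree]
  obtain r0 where r0: "Frac r0" and min0: "\<And>y. Frac y \<Longrightarrow> degree r0 \<le> degree y" by blast
  obtain s where s: "[:p:] dvd r0 ^ 2 * f - [:c:] * s ^ 2" using r0 by (auto simp: Frac_def)
  obtain B where B: "[:p:] dvd r0 - B" "\<not> p dvd lead_coeff B" "degree B \<le> degree r0"
    using poly_mod_reduced[of p r0] r0 unfolding Frac_def by blast
  have "B ^ 2 * f - [:c:] * s ^ 2 = (r0 ^ 2 * f - [:c:] * s ^ 2) - (r0 - B) * ((r0 + B) * f)"
    by (simp add: power2_eq_square algebra_simps)
  then have E: "[:p:] dvd B ^ 2 * f - [:c:] * s ^ 2" (is "_ dvd ?E") using s B(1) by (metis dvd_diff dvd_mult2)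
  have B0: "\<not> [:p:] dvd B" using B(2) by (auto simp: const_poly_dvd_iff)
  have minB: "degree B \<le> degree y" if "Frac y" for y using min0[OF that] B(3) by simp
  \<comment> \<open>Pseudo-division, since the leading coefficient of \<open>B\<close> is invertible
    only modulo \<open>p\<close>; the multiplier \<open>k\<close> is a power of it, hence nonzero
    modulo \<open>p\<close>.\<close>
  obtain q t where qt: "pseudo_divmod s B = (q, t)" by (cases "pseudo_divmod s B")
  define k where "k = lead_coeff B ^ (Suc (degree s) - degree B)"
  have "B \<noteq> 0" using B0 by auto
  have k: "\<not> p dvd k" using B(2) p prime_dvd_power unfolding k_def by blast
  have t: "t = [:k:] * s - B * q" and tdeg: "t = 0 \<or> degree t < degree B"
    using pseudo_divmod[OF \<open>B \<noteq> 0\<close> qt] by (simp_all add: k_def)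
  have "[:p:] dvd t"
  proof (rule ccontr)
    assume nt: "\<not> [:p:] dvd t"
    \<comment> \<open>If \<open>theta\<close> denotes the root \<open>s / B\<close>, this is
      \<open>c t theta\<close>, rewritten by means of \<open>c s^2 = B^2 f\<close>. So
      \<open>theta\<close> also has the denominator \<open>c t\<close>, whose degree is below that
      of \<open>B\<close>.\<close>
    define s' where "s' = [:k:] * B * f - [:c:] * q * s"
    have "B ^ 2 * (([:c:] * t) ^ 2 * f - [:c:] * s' ^ 2) =
        ?E * (([:c:] * t) ^ 2 - [:c:] * (2 * [:c:] * s * t * [:k:] + [:k:] ^ 2 * ?E))"
    proof -
      have "B ^ 2 * ((C * (K * s - B * q)) ^ 2 * f - C * (K * B * f - C * q * s) ^ 2) =
        (B ^ 2 * f - C * s ^ 2) * ((C * (K * s - B * q)) ^ 2 -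
          C * (2 * C * s * (K * s - B * q) * K + K ^ 2 * (B ^ 2 * f - C * s ^ 2)))" for C K
        by (simp add: power2_eq_square algebra_simps)
      then show ?thesis unfolding s'_def t .
    qed
    then have "[:p:] dvd B ^ 2 * (([:c:] * t) ^ 2 * f - [:c:] * s' ^ 2)"
      using E by (metis dvd_mult2)
    then have "[:p:] dvd ([:c:] * t) ^ 2 * f - [:c:] * s' ^ 2"
      using p B0 prime_dvd_poly_mult_iff prime_dvd_poly_power_iff by blast
    moreover have "\<not> [:p:] dvd [:c:] * t"
      using p nt c prime_dvd_poly_mult_iff const_poly_dvd_const_poly_iff by blast
    ultimately have "Frac ([:c:] * t)" by (auto simp: Frac_def)
    then have "degree B \<le> degree ([:c:] * t)" by (rule minB)
    moreover have "degree ([:c:] * t) \<le> degree t" by (simp add: degree_smult_le)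
    ultimately show False using tdeg nt by auto
  qed
  \<comment> \<open>As \<open>t\<close> vanishes modulo \<open>p\<close>, \<open>k s\<close> equals
    \<open>B q\<close> there and the root is \<open>q / k\<close>; it remains to cancel
    \<open>B^2\<close>.\<close>
  moreover have "B ^ 2 * ([:k:] ^ 2 * f - [:c:] * q ^ 2) = [:k:] ^ 2 * ?E + t * ([:c:] * ([:k:] * s + B * q))"
  proof -
    have "B ^ 2 * (K ^ 2 * f - C * q ^ 2) = K ^ 2 * (B ^ 2 * f - C * s ^ 2) +
        (K * s - B * q) * (C * (K * s + B * q))" for C K
      by (simp add: power2_eq_square algebra_simps)
    then show ?thesis unfolding t .
  qed
  ultimately have "[:p:] dvd B ^ 2 * ([:k:] ^ 2 * f - [:c:] * q ^ 2)"
    using E by (metis dvd_add dvd_mult dvd_mult2)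
  then have "[:p:] dvd [:k:] ^ 2 * f - [:c:] * q ^ 2"
    using p B0 prime_dvd_poly_mult_iff prime_dvd_poly_power_iff by blast
  then have "[:p:] dvd [:k ^ 2:] * f - [:c:] * q ^ 2" by (simp add: poly_const_pow)
  moreover have "\<not> p dvd k ^ 2" using k p prime_dvd_power by blast
  ultimately show thesis using that by blast
qed

text \<open>If \<open>r\<close> were nonzero, the descent would give \<open>k f = c q^2\<close>
  modulo \<open>p\<close>. Then \<open>q\<close> divides \<open>f\<close> and its derivative, hence
  by the Bezout identity the nonzero constant \<open>k R\<close>; so \<open>q\<close>, and with it
  \<open>f\<close>, would be constant modulo \<open>p\<close>.\<close>

lemma square_root_mod_imp_zero:
  fixes p c R :: int
  assumes p: "prime p" and c: "\<not> p dvd c"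
    and bezout: "U * f + V * pderiv f = [:R:]" "\<not> p dvd R"
    and f: "\<not> p dvd lead_coeff f" "degree f \<ge> 1"
    and rs: "[:p:] dvd r ^ 2 * f - [:c:] * s ^ 2"
  shows "[:p:] dvd r"
proof (rule ccontr)
  assume "\<not> [:p:] dvd r"
  then obtain q k where k: "\<not> p dvd k" and q: "[:p:] dvd [:k:] * f - [:c:] * q ^ 2"
    using square_root_integral_mod[OF p c _ rs] by blast
  obtain E where E: "[:k:] * f - [:c:] * q ^ 2 = [:p:] * E" using q by auto
  have "pderiv ([:k:] * f - [:c:] * q ^ 2) = [:k:] * pderiv f - [:c:] * (2 * q * pderiv q)"
    by (simp add: pderiv_diff pderiv_smult power2_eq_square pderiv_mult algebra_simps smult_add_right)
  moreover have "pderiv ([:p:] * E) = [:p:] * pderiv E" by (simp add: pderiv_smult)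
  ultimately have q': "[:p:] dvd [:k:] * pderiv f - [:c:] * (2 * q * pderiv q)"
    using E by (metis dvd_triv_left)
  \<comment> \<open>The cofactor for which \<open>q W\<close> equals \<open>k R\<close> modulo
    \<open>p\<close>.\<close>
  define W where "W = [:c:] * (U * q + 2 * V * pderiv q)"
  have "q * W - [:k * R:] = q * W - [:k:] * (U * f + V * pderiv f)" unfolding bezout(1) by simp
  also have "\<dots> = - (U * ([:k:] * f - [:c:] * q ^ 2)) - V * ([:k:] * pderiv f - [:c:] * (2 * q * pderiv q))"
  proof -
    have "q * (C * (U * q + 2 * V * pderiv q)) - K * (U * f + V * pderiv f) =
      - (U * (K * f - C * q ^ 2)) - V * (K * pderiv f - C * (2 * q * pderiv q))" for C K
      by (simp add: power2_eq_square algebra_simps)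
    then show ?thesis unfolding W_def .
  qed
  also have "[:p:] dvd \<dots>" using q q' by (meson dvd_diff dvd_minus_iff dvd_mult)
  finally have qW: "[:p:] dvd q * W - [:k * R:]" .
  have "\<not> [:p:] dvd [:k * R:]" using k bezout(2) p by (simp add: prime_dvd_mult_iff)
  then have "\<not> [:p:] dvd q * W" using qW by (metis diff_diff_eq2 dvd_diff cancel_comm_monoid_add_class.diff_cancel add_diff_cancel_left')
  then have "\<not> [:p:] dvd q" "\<not> [:p:] dvd W" by auto
  then obtain B1 B2 where B1: "[:p:] dvd q - B1" "\<not> p dvd lead_coeff B1"
    and B2: "[:p:] dvd W - B2" "\<not> p dvd lead_coeff B2"
    using poly_mod_reduced by metis
  have "[:k * R:] - B1 * B2 = (q - B1) * W + B1 * (W - B2) - (q * W - [:k * R:])"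
    by (simp add: algebra_simps)
  then have "[:p:] dvd [:k * R:] - B1 * B2"
    using B1(1) B2(1) qW by (metis dvd_add dvd_diff dvd_mult dvd_mult2)
  moreover have "\<not> p dvd lead_coeff (B1 * B2)"
    using B1(2) B2(2) p by (simp add: lead_coeff_mult prime_dvd_mult_iff)
  ultimately have "degree (B1 * B2) \<le> degree [:k * R:]" by (rule degree_le_of_lead_coeff_not_dvd)
  moreover have "B1 \<noteq> 0" "B2 \<noteq> 0" using B1(2) B2(2) by auto
  ultimately have d1: "degree B1 = 0" by (simp add: degree_mult_eq)
  have "[:c:] * B1 ^ 2 - [:k:] * f = - ([:k:] * f - [:c:] * q ^ 2) - (q - B1) * ([:c:] * (q + B1))"
  proof -
    have "C * B1 ^ 2 - K * f = - (K * f - C * q ^ 2) - (q - B1) * (C * (q + B1))" for C K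
      by (simp add: power2_eq_square algebra_simps)
    then show ?thesis .
  qed
  then have "[:p:] dvd [:c:] * B1 ^ 2 - [:k:] * f"
    using q B1(1) by (metis dvd_diff dvd_minus_iff dvd_mult2)
  moreover have "\<not> p dvd lead_coeff ([:k:] * f)"
    using k f(1) p by (cases "k = 0") (auto simp: prime_dvd_mult_iff)
  ultimately have "degree ([:k:] * f) \<le> degree ([:c:] * B1 ^ 2)"
    by (rule degree_le_of_lead_coeff_not_dvd)
  also have "\<dots> = 0" using d1 by (simp add: degree_power_le degree_smult_le power2_eq_square degree_mult_eq_0)
  finally have "degree f = 0" using k by (cases "k = 0") auto
  then show False using f(2) by simp
qed

section \<open>Stepanov's method on cosets\<close>

text \<open>Pigeonhole on vectors with entries in \<open>{0..<p}\<close>: there are more of them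
  than tuples of values modulo \<open>p\<close>. The difference of two colliding vectors solves the
  system, and entries that differ do so by less than \<open>p\<close>.\<close>

lemma mod_linear_system:
  fixes \<phi> :: "('i \<Rightarrow> int) \<Rightarrow> 'c \<Rightarrow> int"
  assumes I: "finite I" and E: "finite E" and card: "card E < card I" and p: "p > (1::nat)"
    and add: "\<And>v w c. \<phi> (\<lambda>i. v i - w i) c = \<phi> v c - \<phi> w c"
  shows "\<exists>v. (\<exists>i\<in>I. \<not> int p dvd v i) \<and> (\<forall>c\<in>E. int p dvd \<phi> v c)"
proof -
  define V where "V = PiE I (\<lambda>_. {0..<int p})"
  define \<Psi> where "\<Psi> v = restrict (\<lambda>c. \<phi> v c mod int p) E" for v
  have "\<Psi> ` V \<subseteq> PiE E (\<lambda>_. {0..<int p})" using p by (auto simp: \<Psi>_def)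
  then have "card (\<Psi> ` V) \<le> card (PiE E (\<lambda>_. {0..<int p}))"
    using E by (intro card_mono finite_PiE) auto
  also have "\<dots> = p ^ card E" using E by (simp add: card_PiE)
  also have "\<dots> < p ^ card I" using p card by (rule power_strict_increasing[rotated])
  also have "\<dots> = card V" using I by (simp add: V_def card_PiE)
  finally have "\<not> inj_on \<Psi> V" by (rule pigeonhole)
  then obtain v w where vw: "v \<in> V" "w \<in> V" "\<Psi> v = \<Psi> w" "v \<noteq> w" by (auto simp: inj_on_def)
  obtain i where i: "i \<in> I" "v i \<noteq> w i"
    using vw(1,2,4) PiE_ext unfolding V_def by blast
  have "v i \<in> {0..<int p}" "w i \<in> {0..<int p}" using vw(1,2) i(1) by (auto simp: V_def)
  then have "\<not> int p dvd v i - w i"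
    using i(2) zdvd_imp_le[of "int p" "\<bar>v i - w i\<bar>"] by auto
  moreover have "int p dvd \<phi> (\<lambda>i. v i - w i) c" if "c \<in> E" for c
  proof -
    have "\<phi> v c mod int p = \<phi> w c mod int p"
      using fun_cong[OF vw(3), of c] that by (simp add: \<Psi>_def)
    then show ?thesis unfolding add by (rule mod_eq_dvd_iff[THEN iffD1])
  qed
  ultimately show ?thesis using i(1) by (intro exI[of _ "\<lambda>i. v i - w i"]) blast
qed

text \<open>The action of \<open>X f d/dX\<close> on \<open>f^n X^i g\<close> with the prefactor
  \<open>f^n X^i\<close> taken out: the factors \<open>X\<close> and \<open>f\<close> of the
  derivation restore the powers lost by differentiating. The prefactors thus survive repeated
  derivation and can be replaced by constants at the points of interest.\<close>

definition euler_op :: "int poly \<Rightarrow> nat \<Rightarrow> nat \<Rightarrow> int poly \<Rightarrow> int poly" where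
  "euler_op f n i g = [:0, 1:] * f * pderiv g
     + (smult (int n) ([:0, 1:] * pderiv f) + smult (int i) f) * g"

lemma derivation_term:
  "([:0, 1:] * f) * pderiv (f ^ n * monom 1 i * g) = f ^ n * monom 1 i * euler_op f n i g"
proof -
  have 1: "f * pderiv (f ^ n) = [:int n:] * (f ^ n * pderiv f)"
  proof (cases n)
    case (Suc k)
    show ?thesis unfolding Suc pderiv_power_Suc by (simp add: mult.assoc)
  qed simp
  have 2: "[:0, 1:] * pderiv (monom 1 i) = [:int i:] * monom 1 i"
  proof (cases i)
    case (Suc k)
    show ?thesis unfolding Suc pderiv_monom by (simp add: smult_monom monom_Suc)
  qed simp
  have "(Y * f) * pderiv (f ^ n * monom 1 i * g) =
     f ^ n * monom 1 i * (Y * f * pderiv g) + Y * (f * pderiv (f ^ n)) * (monom 1 i * g)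
     + (Y * pderiv (monom 1 i)) * (f ^ n * f * g)" for Y
    by (simp add: pderiv_mult algebra_simps)
  from this[of "[:0, 1:]"] have "([:0, 1:] * f) * pderiv (f ^ n * monom 1 i * g) =
     f ^ n * monom 1 i * ([:0, 1:] * f * pderiv g)
     + [:0, 1:] * ([:int n:] * (f ^ n * pderiv f)) * (monom 1 i * g)
     + ([:int i:] * monom 1 i) * (f ^ n * f * g)" unfolding 1 2 .
  also have "\<dots> = f ^ n * monom 1 i * ([:0, 1:] * f * pderiv g
     + ([:int n:] * ([:0, 1:] * pderiv f) + [:int i:] * f) * g)"
  proof -
    have "F * M * (Y * f * pderiv g) + Y * (A * (F * pderiv f)) * (M * g) + (B * M) * (F * f * g)
      = F * M * (Y * f * pderiv g + (A * (Y * pderiv f) + B * f) * g)" for F M Y A B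
      by (simp add: algebra_simps)
    then show ?thesis .
  qed
  finally show ?thesis by (simp add: euler_op_def)
qed

lemma derivation_sum_terms:
  "((\<lambda>P. ([:0, 1:] * f) * pderiv P) ^^ k) (\<Sum>t\<in>A. f ^ n t * monom 1 (i t) * g t)
    = (\<Sum>t\<in>A. f ^ n t * monom 1 (i t) * (euler_op f (n t) (i t) ^^ k) (g t))"
proof (induction k)
  case (Suc k)
  show ?case
    by (simp only: funpow.simps o_apply Suc.IH higher_pderiv_sum[of 1, simplified] sum_distrib_left derivation_term)
qed simp

lemma euler_op_diff: "euler_op f n i (g - h) = euler_op f n i g - euler_op f n i h"
  unfolding euler_op_def pderiv_diff by (simp only: right_diff_distrib add_diff_add)

lemma euler_op_funpow_diff:
  "(euler_op f n i ^^ k) (g - h) = (euler_op f n i ^^ k) g - (euler_op f n i ^^ k) h"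
  by (induction k) (simp_all add: euler_op_diff)

lemma degree_euler_op: "degree (euler_op f n i g) \<le> degree g + degree f"
proof -
  have X: "degree ([:0, 1:] * h) \<le> degree h + 1" for h :: "int poly"
    by (simp add: degree_pCons_le)
  have Xp: "degree ([:0, 1:] * pderiv h) \<le> degree h" for h :: "int poly"
  proof (cases "degree h = 0")
    case True
    then have "pderiv h = 0" by (simp add: pderiv_eq_0_iff)
    then show ?thesis by simp
  next
    case False
    then show ?thesis using X[of "pderiv h"] by (simp add: degree_pderiv)
  qed
  have "degree (f * ([:0, 1:] * pderiv g)) \<le> degree f + degree g"
    by (rule order_trans[OF degree_mult_le add_left_mono[OF Xp]])
  then have "degree ([:0, 1:] * f * pderiv g) \<le> degree g + degree f"
    by (simp add: ac_simps)
  moreover have "degree (smult (int n) ([:0, 1:] * pderiv f) + smult (int i) f) \<le> degree f"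
    by (intro degree_add_le order_trans[OF degree_smult_le] Xp) auto
  then have "degree ((smult (int n) ([:0, 1:] * pderiv f) + smult (int i) f) * g) \<le> degree g + degree f"
    by (intro order_trans[OF degree_mult_le]) auto
  ultimately show ?thesis unfolding euler_op_def by (rule degree_add_le)
qed

lemma degree_euler_op_funpow: "degree ((euler_op f n i ^^ k) g) \<le> degree g + k * degree f"
proof (induction k)
  case (Suc k)
  then show ?case using degree_euler_op[of f n i "(euler_op f n i ^^ k) g"] by simp
qed simp

text \<open>The auxiliary polynomial is \<open>\<Sum> f\<^bsup>e b\<^esup> X\<^bsup>r j\<^esup> g\<^bsub>b,j\<^esub>\<close> over \<open>b < 2\<close>, \<open>j < J\<close>. At a point with
  \<open>X\<^bsup>r\<^esup> = C\<close> and \<open>f\<^bsup>e\<^esup> = a\<close> its \<open>k\<close>-th derivative along \<open>X f d/dX\<close> takes the value of a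
  polynomial of small degree, so a few linear conditions make it vanish at all these points.\<close>

lemma auxiliary_coefficients:
  fixes C a :: int
  assumes p: "p > (1::nat)" and K: "K \<ge> 1"
    and count: "(\<Sum>k<l. K + k * degree f) < 2 * J * K"
  shows "\<exists>g :: nat \<times> nat \<Rightarrow> int poly. (\<forall>t. degree (g t) < K) \<and>
    (\<exists>t\<in>{..<2} \<times> {..<J}. \<not> [:int p:] dvd g t) \<and>
    (\<forall>k<l. [:int p:] dvd (\<Sum>(b, j)\<in>{..<2} \<times> {..<J}. smult (a ^ b * C ^ j)
        ((euler_op f (b * e) (j * r) ^^ k) (g (b, j)))))"
proof -
  define G where "G v t = (\<Sum>i<K. monom (v (t, i)) i)" for v :: "(nat \<times> nat) \<times> nat \<Rightarrow> int" and t
  define T where "T k g = (\<Sum>(b, j)\<in>{..<2} \<times> {..<J}. smult (a ^ b * C ^ j)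
        ((euler_op f (b * e) (j * r) ^^ k) (g (b, j))))" for k and g :: "nat \<times> nat \<Rightarrow> int poly"
  define I where "I = (({..<2} \<times> {..<J}) \<times> {..<K} :: ((nat \<times> nat) \<times> nat) set)"
  \<comment> \<open>\<open>I\<close> lists the \<open>2 * J * K\<close> unknown coefficients and
    \<open>E\<close> the conditions: the \<open>k\<close>-th combination has degree below
    \<open>K + k * degree f\<close>, and each of its coefficients must vanish modulo
    \<open>p\<close>.\<close>
  define E where "E = Sigma {..<l} (\<lambda>k. {..<K + k * degree f})"
  have G_diff: "G (\<lambda>i. v i - w i) = (\<lambda>t. G v t - G w t)" for v w
    by (simp add: G_def fun_eq_iff sum_subtractf diff_monom[symmetric])
  have T_diff: "T k (\<lambda>t. g t - h t) = T k g - T k h" for k g h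
    by (simp add: T_def euler_op_funpow_diff smult_diff_right sum_subtractf case_prod_unfold)
  have "\<exists>v. (\<exists>i\<in>I. \<not> int p dvd v i) \<and> (\<forall>c\<in>E. int p dvd coeff (T (fst c) (G v)) (snd c))"
  proof (rule mod_linear_system)
    show "card E < card I" using count by (simp add: I_def E_def card_cartesian_product)
    show "coeff (T (fst c) (G (\<lambda>i. v i - w i))) (snd c) =
        coeff (T (fst c) (G v)) (snd c) - coeff (T (fst c) (G w)) (snd c)" for v w c
      unfolding G_diff T_diff by simp
  qed (use p in \<open>auto simp: I_def E_def\<close>)
  then obtain v where v: "\<exists>i\<in>I. \<not> int p dvd v i"
    and vE: "\<And>k i. k < l \<Longrightarrow> i < K + k * degree f \<Longrightarrow> int p dvd coeff (T k (G v)) i"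
    by (auto simp: E_def)
  have deg: "degree (G v t) < K" for t
    unfolding G_def using K
    by (intro degree_sum_less) (auto intro: le_less_trans[OF degree_monom_le])
  have cf: "coeff (G v t) i = v (t, i)" if "i < K" for t i
    using that by (simp add: G_def coeff_sum coeff_monom)
  have "\<exists>t\<in>{..<2} \<times> {..<J}. \<not> [:int p:] dvd G v t"
  proof -
    obtain t i where ti: "t \<in> {..<2} \<times> {..<J}" "i < K" "\<not> int p dvd v (t, i)"
      using v by (auto simp: I_def)
    then have "\<not> [:int p:] dvd G v t" using cf[of i t] unfolding const_poly_dvd_iff by metis
    then show ?thesis using ti(1) by blast
  qed
  moreover have "[:int p:] dvd T k (G v)" if "k < l" for k
    unfolding const_poly_dvd_iff
  proof
    fix i
    have "degree (T k (G v)) < K + k * degree f"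
      unfolding T_def case_prod_unfold
    proof (rule degree_sum_less)
      fix t
      have "degree ((euler_op f (fst t * e) (snd t * r) ^^ k) (G v (fst t, snd t))) < K + k * degree f"
        by (rule le_less_trans[OF degree_euler_op_funpow]) (simp add: deg)
      then show "degree (smult (a ^ fst t * C ^ snd t) ((euler_op f (fst t * e) (snd t * r) ^^ k) (G v (fst t, snd t))))
         < K + k * degree f" by (rule le_less_trans[OF degree_smult_le])
    qed (use K in simp)
    then show "int p dvd coeff (T k (G v)) i"
      using vE[OF that, of i] by (cases "i < K + k * degree f") (auto simp: coeff_eq_0)
  qed
  ultimately show ?thesis using deg unfolding T_def by blast
qed

text \<open>Let \<open>j0\<close> be the first index with a nonzero pair \<open>s0\<close>,
  \<open>s1\<close>, everything modulo \<open>p\<close>. Dividing a vanishing sum by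
  \<open>X^(j0 r)\<close> leaves \<open>s0 + f^e s1 = 0\<close> modulo \<open>X^r\<close>.
  Multiplication by \<open>f (s0 - f^e s1)\<close>, together with
  \<open>f^(2e+1) = f^p = f(0)\<close>, gives \<open>f s0^2 = f(0) s1^2\<close> modulo
  \<open>X^r\<close>, and by degrees exactly. Then \<open>f / f(0)\<close> would be a square unless
  \<open>s0\<close>, and hence \<open>s1\<close>, vanishes.\<close>

lemma auxiliary_nonzero:
  fixes g :: "nat \<times> nat \<Rightarrow> int poly"
  assumes p: "prime p" and e: "p = 2 * e + 1" and r: "r \<le> p"
    and bezout: "U * f + V * pderiv f = [:R:]" "\<not> int p dvd R"
    and f: "\<not> int p dvd lead_coeff f" "degree f \<ge> 1" "\<not> int p dvd poly f 0"
    and deg: "\<And>t. degree (g t) < K" and K: "2 * (K - 1) + degree f < r"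
    and nz: "\<exists>t\<in>{..<2} \<times> {..<J}. \<not> [:int p:] dvd g t"
  shows "\<not> [:int p:] dvd (\<Sum>(b, j)\<in>{..<2} \<times> {..<J}. f ^ (b * e) * monom 1 (j * r) * g (b, j))"
proof
  assume zero: "[:int p:] dvd (\<Sum>(b, j)\<in>{..<2} \<times> {..<J}. f ^ (b * e) * monom 1 (j * r) * g (b, j))"
  define h where "h j = g (0, j) + f ^ e * g (1, j)" for j
  define bad where "bad j \<longleftrightarrow> j < J \<and> (\<not> [:int p:] dvd g (0, j) \<or> \<not> [:int p:] dvd g (1, j))" for j
  have pp: "prime (int p)" using p by simp
  have two: "{..<2} = {0, 1::nat}" by auto
  have sum_h: "(\<Sum>(b, j)\<in>{..<2} \<times> {..<J}. f ^ (b * e) * monom 1 (j * r) * g (b, j))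
      = (\<Sum>j<J. monom 1 (j * r) * h j)"
    unfolding sum.cartesian_product[symmetric] two
    by (simp add: h_def sum.distrib algebra_simps)
  obtain j0 where j0: "bad j0" and min: "\<And>j. j < j0 \<Longrightarrow> \<not> bad j"
  proof -
    obtain b j where "b < 2" "j < J" "\<not> [:int p:] dvd g (b, j)" using nz by auto
    then have "bad j" unfolding bad_def by (cases b) (auto simp: less_Suc_eq numeral_2_eq_2)
    then show thesis using that[of "LEAST j. bad j"] LeastI[of bad] not_less_Least by metis
  qed
  define H where "H = (\<Sum>j\<in>{j0 + 1..<J}. monom 1 ((j - j0 - 1) * r) * h j)"
  have "(\<Sum>j<J. monom 1 (j * r) * h j) = (\<Sum>j<j0. monom 1 (j * r) * h j) + (\<Sum>j\<in>{j0..<J}. monom 1 (j * r) * h j)"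
    using j0 by (subst sum.union_disjoint[symmetric]) (auto simp: bad_def ivl_disj_un intro!: sum.cong)
  moreover have "(\<Sum>j\<in>{j0..<J}. monom 1 (j * r) * h j) = monom 1 (j0 * r) * (h j0 + monom 1 r * H)"
  proof -
    have "(\<Sum>j\<in>{j0..<J}. monom 1 (j * r) * h j) = monom 1 (j0 * r) * h j0 + (\<Sum>j\<in>{j0 + 1..<J}. monom 1 (j * r) * h j)"
      using j0 by (simp add: bad_def sum.atLeast_Suc_lessThan)
    also have "(\<Sum>j\<in>{j0 + 1..<J}. monom 1 (j * r) * h j) = (\<Sum>j\<in>{j0 + 1..<J}. monom 1 (j0 * r) * (monom 1 r * (monom 1 ((j - j0 - 1) * r) * h j)))"
    proof (rule sum.cong)
      fix j assume "j \<in> {j0 + 1..<J}"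
      then obtain i where "j = j0 + 1 + i" by (metis atLeastLessThan_iff le_Suc_ex)
      then show "monom 1 (j * r) * h j = monom 1 (j0 * r) * (monom 1 r * (monom 1 ((j - j0 - 1) * r) * h j))"
        by (simp add: mult.assoc[symmetric] mult_monom algebra_simps)
    qed simp
    finally show ?thesis by (simp add: H_def sum_distrib_left distrib_left)
  qed
  moreover have low: "[:int p:] dvd (\<Sum>j<j0. monom 1 (j * r) * h j)"
  proof (rule dvd_sum)
    fix j assume "j \<in> {..<j0}"
    then have "[:int p:] dvd g (0, j)" "[:int p:] dvd g (1, j)" using min j0 by (auto simp: bad_def)
    then show "[:int p:] dvd monom 1 (j * r) * h j" unfolding h_def by (meson dvd_add dvd_mult)
  qed
  ultimately have "[:int p:] dvd monom 1 (j0 * r) * (h j0 + monom 1 r * H)"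
    using zero dvd_add_right_iff[OF low] unfolding sum_h by simp
  moreover have "\<not> [:int p:] dvd monom 1 (j0 * r)"
    using p by (auto simp: const_poly_dvd_iff coeff_monom)
  ultimately have h: "[:int p:] dvd h j0 + monom 1 r * H" using prime_dvd_poly_mult_iff[OF pp] by blast
  define s0 s1 c where "s0 = g (0, j0)" "s1 = g (1, j0)" "c = poly f 0"
  note defs = this
  obtain G where G: "[:int p:] dvd f ^ p - [:c:] - monom 1 p * G"
    using poly_power_prime_mod[OF p] unfolding defs by blast
  have mp: "monom 1 p = monom 1 r * (monom 1 (p - r) :: int poly)"
    using r by (simp add: mult_monom)
  define W where "W = s1 ^ 2 * monom 1 (p - r) * G - f * (s0 - f ^ e * s1) * H"
  have fp: "f ^ p = f * f ^ e * f ^ e" using e by (simp add: power_add mult_2)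
  have "s0 ^ 2 * f - [:c:] * s1 ^ 2 - monom 1 r * W =
     f * (s0 - f ^ e * s1) * (h j0 + monom 1 r * H) + s1 ^ 2 * (f ^ p - [:c:] - monom 1 p * G)"
  proof -
    have "s0 ^ 2 * f - C * s1 ^ 2 - M * (s1 ^ 2 * M' * G - f * (s0 - F * s1) * H) =
      f * (s0 - F * s1) * ((s0 + F * s1) + M * H) + s1 ^ 2 * (f * F * F - C - M * M' * G)" for C M M' F
      by (simp add: power2_eq_square algebra_simps)
    then show ?thesis unfolding W_def mp fp h_def defs(1,2)[symmetric] .
  qed
  then have W: "[:int p:] dvd s0 ^ 2 * f - [:c:] * s1 ^ 2 - monom 1 r * W"
    using h G by (metis dvd_add dvd_mult)
  have "[:int p:] dvd s0 ^ 2 * f - [:c:] * s1 ^ 2"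
    unfolding const_poly_dvd_iff
  proof
    fix i
    show "int p dvd coeff (s0 ^ 2 * f - [:c:] * s1 ^ 2) i"
    proof (cases "i < r")
      case True
      then have "coeff (monom 1 r * W) i = 0" by (simp add: coeff_monom_mult)
      then show ?thesis using W unfolding const_poly_dvd_iff by (metis coeff_diff diff_0_right)
    next
      case False
      have d: "degree s0 \<le> K - 1" "degree s1 \<le> K - 1"
        using deg[of "(0, j0)"] deg[of "(1, j0)"] by (auto simp: defs)
      have "degree (s0 ^ 2 * f) \<le> 2 * (K - 1) + degree f"
        using d by (intro order_trans[OF degree_mult_le] add_mono order_trans[OF degree_power_le]) auto
      moreover have "degree ([:c:] * s1 ^ 2) \<le> 2 * (K - 1)"
        using d by (intro order_trans[OF degree_mult_le] order_trans[OF degree_power_le]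
            order_trans[OF add_mono[OF order_refl degree_power_le]]) auto
      ultimately have "degree (s0 ^ 2 * f - [:c:] * s1 ^ 2) < r"
        using K by (intro le_less_trans[OF degree_diff_le]) auto
      then have "coeff (s0 ^ 2 * f - [:c:] * s1 ^ 2) i = 0" using False by (intro coeff_eq_0) simp
      then show ?thesis by (simp only: dvd_0_right)
    qed
  qed
  note sq = this
  have c: "\<not> int p dvd c" using f(3) by (simp add: defs)
  have s0: "[:int p:] dvd s0"
    by (rule square_root_mod_imp_zero[OF pp c bezout f(1,2) sq])
  then have "[:int p:] dvd s0 ^ 2 * f" by (simp add: power2_eq_square)
  then have "[:int p:] dvd [:c:] * s1 ^ 2" using sq by (metis dvd_diff_right_iff)
  then have "[:int p:] dvd s1"
    using c prime_dvd_poly_mult_iff[OF pp] prime_dvd_poly_power_iff[OF pp] const_poly_dvd_const_poly_iff by metis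
  then show False using s0 j0 by (auto simp: bad_def defs)
qed

text \<open>The parameters: multiplicity \<open>8 d m\<close> at every point, \<open>J = 5 d m\<close> blocks, coefficients
  of degree at most \<open>16 d\<^sup>2 m\<close>.\<close>

theorem stepanov_coset_bound:
  fixes f :: "int poly" and C a :: int
  assumes p: "prime p" and pm: "p = m * r + 1" and m: "m \<ge> 1" "even (m * r)"
    and bezout: "U * f + V * pderiv f = [:R:]" "\<not> int p dvd R"
    and f: "\<not> int p dvd lead_coeff f" "degree f \<ge> 1" "\<not> int p dvd poly f 0"
    and C: "\<not> int p dvd C" and r: "33 * (degree f)\<^sup>2 * m < r"
  shows "16 * card {x \<in> {0..<int p}. [x ^ r = C] (mod int p) \<and> \<not> int p dvd poly f x \<and>
      [poly f x ^ ((p - 1) div 2) = a] (mod int p)} \<le> 11 * r"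
proof -
  define d e l J K where "d = degree f" "e = (p - 1) div 2" "l = 8 * d * m" "J = 5 * d * m"
    "K = 16 * d\<^sup>2 * m + 1"
  note defs = this
  define Z where "Z = {x \<in> {0..<int p}. [x ^ r = C] (mod int p) \<and> \<not> int p dvd poly f x \<and>
      [poly f x ^ e = a] (mod int p)}"
  have pe: "p = 2 * e + 1" using m(2) pm by (simp add: defs)
  have d1: "d \<ge> 1" using f(2) by (simp add: defs)
  have rr: "33 * d\<^sup>2 * m < r" using r by (simp add: defs)
  have dm1: "d * m \<ge> 1" using d1 m(1) by simp
  have dd: "d \<le> d\<^sup>2 * m" using d1 m(1) by (simp add: power2_eq_square)
  have pp: "prime (int p)" using p by simp
  have "1 * r \<le> m * r" using m(1) by (rule mult_le_mono1)
  then have rp: "r \<le> p" using pm by linarith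
  have sum_l: "(\<Sum>k<l. k) * 2 \<le> l * l"
    by (induction l) auto
  \<comment> \<open>Twice the number of conditions is at most \<open>2 l K + d l^2\<close>. The
    first term is \<open>16 d m K\<close> and the second, \<open>64 d^3 m^2\<close>, is below
    \<open>4 d m K\<close>.\<close>
  have count: "(\<Sum>k<l. K + k * d) < 2 * J * K"
  proof -
    have "2 * (\<Sum>k<l. K + k * d) = 2 * l * K + d * ((\<Sum>k<l. k) * 2)"
      by (simp add: sum.distrib sum_distrib_left sum_distrib_right mult_ac)
    also have "\<dots> \<le> 2 * l * K + d * (l * l)" using sum_l by simp
    also have "d * (l * l) < 4 * (d * m) * K"
    proof -
      have "d * (l * l) = 4 * (d * m) * (16 * d\<^sup>2 * m)" by (simp add: defs power2_eq_square)
      also have "\<dots> < 4 * (d * m) * K" using dm1 by (simp add: defs(5))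
      finally show ?thesis .
    qed
    also have "2 * l * K + 4 * (d * m) * K = 2 * (2 * J * K)"
      by (simp add: defs(3,4) algebra_simps)
    finally show ?thesis by simp
  qed
  have "\<exists>g :: nat \<times> nat \<Rightarrow> int poly. (\<forall>t. degree (g t) < K) \<and>
    (\<exists>t\<in>{..<2} \<times> {..<J}. \<not> [:int p:] dvd g t) \<and>
    (\<forall>k<l. [:int p:] dvd (\<Sum>(b, j)\<in>{..<2} \<times> {..<J}. smult (a ^ b * C ^ j)
        ((euler_op f (b * e) (j * r) ^^ k) (g (b, j)))))"
    using count prime_gt_1_nat[OF p] by (intro auxiliary_coefficients) (auto simp: defs)
  then obtain g :: "nat \<times> nat \<Rightarrow> int poly" where deg: "\<And>t. degree (g t) < K"
    and nz: "\<exists>t\<in>{..<2} \<times> {..<J}. \<not> [:int p:] dvd g t"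
    and T: "\<And>k. k < l \<Longrightarrow> [:int p:] dvd (\<Sum>(b, j)\<in>{..<2} \<times> {..<J}. smult (a ^ b * C ^ j)
        ((euler_op f (b * e) (j * r) ^^ k) (g (b, j))))" by blast
  define P where "P = (\<Sum>t\<in>{..<2} \<times> {..<J}. f ^ (fst t * e) * monom 1 (snd t * r) * g t)"
  have P: "\<not> [:int p:] dvd P"
  proof -
    have "2 * (K - 1) + degree f < r" using rr dd by (simp add: defs)
    then show ?thesis
      using auxiliary_nonzero[OF p pe rp bezout f deg _ nz] by (simp add: P_def case_prod_unfold)
  qed
  have "l * card Z \<le> degree P"
  proof (rule multiple_roots_mod_bound[OF pp _ _ _ P])
    show "finite Z" unfolding Z_def by (rule finite_subset[of _ "{0..<int p}"]) auto
    show "x = y" if "x \<in> Z" "y \<in> Z" "int p dvd x - y" for x y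
    proof -
      have "x mod int p = y mod int p" using that(3) by (simp add: mod_eq_dvd_iff)
      then show ?thesis using that(1,2) by (simp add: Z_def)
    qed
    fix x assume x: "x \<in> Z"
    show "\<exists>Q. [:int p:] dvd P - [:- x, 1:] ^ l * Q"
    proof (rule multiple_root_mod_by_derivation[OF pp, of "[:0, 1:] * f"])
      have "\<not> int p dvd x"
      proof
        assume "int p dvd x"
        moreover have "x dvd x ^ r" using rr by (intro dvd_power) auto
        ultimately have "int p dvd x ^ r" by (rule dvd_trans)
        then show False using x C by (auto simp: Z_def dest: cong_dvd_iff)
      qed
      then show "\<not> int p dvd poly ([:0, 1:] * f) x"
        using x pp by (simp add: Z_def prime_dvd_mult_iff)
      have "l \<le> 33 * d\<^sup>2 * m" using d1 by (simp add: defs power2_eq_square)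
      also have "\<dots> \<le> p" using rr rp by linarith
      finally show "int l \<le> int p" by simp
      fix k assume k: "k < l"
      define h where "h t = (euler_op f (fst t * e) (snd t * r) ^^ k) (g t)" for t
      \<comment> \<open>At a point of \<open>Z\<close> the surviving prefactors become powers of
        \<open>a\<close> and \<open>C\<close>, which leaves a value of the combination that
        \<open>g\<close> makes zero modulo \<open>p\<close>.\<close>
      have "poly (((\<lambda>P. [:0, 1:] * f * pderiv P) ^^ k) P) x =
          (\<Sum>t\<in>{..<2} \<times> {..<J}. (poly f x ^ e) ^ fst t * (x ^ r) ^ snd t * poly (h t) x)"
        unfolding P_def derivation_sum_terms
        by (simp add: poly_sum poly_monom h_def mult.commute flip: power_mult)
      also have "[\<dots> = (\<Sum>t\<in>{..<2} \<times> {..<J}. a ^ fst t * C ^ snd t * poly (h t) x)] (mod int p)"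
        using x by (intro cong_sum cong_mult cong_pow) (auto simp: Z_def)
      also have "(\<Sum>t\<in>{..<2} \<times> {..<J}. a ^ fst t * C ^ snd t * poly (h t) x) =
          poly (\<Sum>(b, j)\<in>{..<2} \<times> {..<J}. smult (a ^ b * C ^ j)
            ((euler_op f (b * e) (j * r) ^^ k) (g (b, j)))) x"
        by (simp add: poly_sum h_def case_prod_unfold)
      also have "[\<dots> = 0] (mod int p)"
        using poly_dvd_of_const_poly_dvd[OF T[OF k]] by (simp add: cong_0_iff)
      finally show "int p dvd poly (((\<lambda>P. [:0, 1:] * f * pderiv P) ^^ k) P) x"
        by (simp add: cong_0_iff)
    qed
  qed
  also have "degree P \<le> e * d + (J - 1) * r + (K - 1)"
    unfolding P_def
  proof (rule degree_sum_le)
    fix t :: "nat \<times> nat" assume t: "t \<in> {..<2} \<times> {..<J}"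
    have "degree (f ^ (fst t * e)) \<le> d * (fst t * e)" unfolding defs(1) by (rule degree_power_le)
    also have "\<dots> \<le> d * (1 * e)" using t by (intro mult_le_mono) auto
    finally have 1: "degree (f ^ (fst t * e)) \<le> e * d" by (simp add: mult.commute)
    have "degree (monom (1::int) (snd t * r)) \<le> snd t * r" by (rule degree_monom_le)
    also have "\<dots> \<le> (J - 1) * r" using t by (intro mult_le_mono) auto
    finally have 2: "degree (monom (1::int) (snd t * r)) \<le> (J - 1) * r" .
    show "degree (f ^ (fst t * e) * monom 1 (snd t * r) * g t) \<le> e * d + (J - 1) * r + (K - 1)"
      using deg[of t] by (intro order_trans[OF degree_mult_le] add_mono 1 2) auto
  qed simp
  finally have "l * card Z \<le> e * d + (J - 1) * r + (K - 1)" .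
  moreover have "K - 1 \<le> r" using rr by (simp add: defs)
  moreover have "(J - 1) * r + r = J * r" using dm1 by (simp add: defs add.commute flip: mult_Suc)
  ultimately have "l * card Z \<le> e * d + J * r" by linarith
  \<comment> \<open>Here \<open>2 e d = d m r\<close> and \<open>2 J r = 10 d m r\<close>, which add
    up to the constant 11.\<close>
  then have "2 * (l * card Z) \<le> (2 * e) * d + 2 * J * r" by simp
  also have "2 * e = m * r" using pe pm by simp
  finally have "(d * m) * (16 * card Z) \<le> (d * m) * (11 * r)"
    by (simp add: defs(3,4) algebra_simps)
  then have "16 * card Z \<le> 11 * r" using dm1 by simp
  then show ?thesis by (simp add: Z_def defs)
qed

section \<open>Averaging over cosets\<close>

definition box_sum :: "nat \<Rightarrow> (int \<Rightarrow> real) \<Rightarrow> int \<Rightarrow> real" where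
  "box_sum L F n = (\<Sum>a<L. F (n + int a))"

lemma box_sum_add: "box_sum (T + L) F n = box_sum T F n + box_sum L F (n + int T)"
proof -
  have "(\<Sum>a<T + L. F (n + int a)) = (\<Sum>a<T. F (n + int a)) + (\<Sum>a<L. F (n + int (T + a)))"
    by (induction L) auto
  then show ?thesis by (simp add: box_sum_def add.assoc)
qed

lemma box_sum_commute: "box_sum T (box_sum L F) n = box_sum L (box_sum T F) n"
  unfolding box_sum_def by (subst sum.swap) (simp add: ac_simps)

lemma box_sum_eq: "box_sum L F n = (\<Sum>x\<in>{n..<n + int L}. F x)"
  unfolding box_sum_def
  by (rule sum.reindex_bij_witness[of _ "\<lambda>x. nat (x - n)" "\<lambda>a. n + int a"]) auto

lemma box_sum_periodic:
  assumes per: "\<And>n. F (n + int T) = F n"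
  shows "box_sum T F (n + int q) = box_sum T F n"
proof (induction q)
  case (Suc q)
  have "box_sum T F (n + int q) + box_sum 1 F (n + int q + int T)
      = box_sum 1 F (n + int q) + box_sum T F (n + int q + 1)"
    using box_sum_add[of T 1 F "n + int q"] box_sum_add[of 1 T F "n + int q"] by (simp add: add.commute)
  then show ?case using Suc per[of "n + int q"] by (simp add: box_sum_def ac_simps)
qed simp

lemma box_sum_abs_le:
  assumes "\<And>n. \<bar>F n\<bar> \<le> V"
  shows "\<bar>box_sum L F n\<bar> \<le> real L * V"
proof -
  have "\<bar>box_sum L F n\<bar> \<le> (\<Sum>a<L. V)"
    unfolding box_sum_def by (rule order_trans[OF sum_abs sum_mono]) (rule assms)
  then show ?thesis by simp
qed

text \<open>Whole periods contribute nothing, so at most \<open>T\<close> terms remain, however long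
  the box.\<close>

lemma box_sum_mean_zero_bound:
  assumes T: "T > 0" and zero: "\<And>n. box_sum T F n = 0" and V: "\<And>n. \<bar>F n\<bar> \<le> V"
  shows "\<bar>box_sum L F n\<bar> \<le> real T * V"
proof (induction L arbitrary: n rule: less_induct)
  case (less L)
  have V0: "V \<ge> 0" using V[of 0] by linarith
  show ?case
  proof (cases "L \<le> T")
    case True
    have "\<bar>box_sum L F n\<bar> \<le> real L * V" by (rule box_sum_abs_le) (rule V)
    also have "\<dots> \<le> real T * V" using True V0 by (simp add: mult_right_mono)
    finally show ?thesis .
  next
    case False
    then have "L = T + (L - T)" by simp
    then have "box_sum L F n = box_sum (L - T) F (n + int T)"
      using box_sum_add[of T "L - T" F n] zero by simp
    then show ?thesis using less.IH[of "L - T"] T False by simp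
  qed
qed

text \<open>Box sums commute, so mean zero over a period persists and every iteration costs a factor
  \<open>T\<close> instead of the trivial \<open>L\<close>. For \<open>T < L\<close> the gain grows
  with \<open>k\<close>, as it would for a smooth weight.\<close>

lemma box_sum_funpow_mean_zero_bound:
  assumes T: "T > 0" and zero: "\<And>n. box_sum T F n = 0" and V: "\<And>n. \<bar>F n\<bar> \<le> V"
  shows "\<bar>(box_sum L ^^ k) F n\<bar> \<le> real T ^ k * V"
proof -
  have "(\<forall>n. box_sum T ((box_sum L ^^ k) F) n = 0) \<and> (\<forall>n. \<bar>(box_sum L ^^ k) F n\<bar> \<le> real T ^ k * V)"
  proof (induction k)
    case (Suc k)
    have "box_sum T ((box_sum L ^^ k) F) = (\<lambda>_. 0)" using Suc.IH by blast
    then have "box_sum T (box_sum L ((box_sum L ^^ k) F)) n = 0" for n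
      by (simp only: box_sum_commute[of T]) (simp add: box_sum_def)
    moreover have "\<bar>box_sum L ((box_sum L ^^ k) F) n\<bar> \<le> real T * (real T ^ k * V)" for n
      using Suc.IH T by (intro box_sum_mean_zero_bound) auto
    ultimately show ?case by (simp add: mult.assoc)
  qed (use assms in auto)
  then show ?thesis by blast
qed

lemma box_sum_funpow_abs_le:
  assumes "\<And>n. \<bar>F n\<bar> \<le> V"
  shows "\<bar>(box_sum L ^^ k) F n\<bar> \<le> real L ^ k * V"
proof (induction k arbitrary: n)
  case (Suc k)
  have "\<bar>box_sum L ((box_sum L ^^ k) F) n\<bar> \<le> real L * (real L ^ k * V)"
    by (rule box_sum_abs_le) (rule Suc.IH)
  then show ?case by (simp add: mult.assoc)
qed (use assms in auto)

lemma box_sum_sum: "box_sum L (\<lambda>n. \<Sum>i\<in>A. F i n) n = (\<Sum>i\<in>A. box_sum L (F i) n)"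
  unfolding box_sum_def by (rule sum.swap)

lemma box_sum_funpow_sum:
  "(box_sum L ^^ k) (\<lambda>n. \<Sum>i\<in>A. F i n) n = (\<Sum>i\<in>A. (box_sum L ^^ k) (F i) n)"
proof (induction k arbitrary: n)
  case (Suc k)
  have "(box_sum L ^^ k) (\<lambda>n. \<Sum>i\<in>A. F i n) = (\<lambda>n. \<Sum>i\<in>A. (box_sum L ^^ k) (F i) n)"
    using Suc.IH by blast
  then show ?case by (simp add: box_sum_sum)
qed simp

lemma box_sum_funpow_nonneg:
  assumes "\<And>n. F n \<ge> 0"
  shows "(box_sum L ^^ k) F n \<ge> 0"
  using assms by (induction k arbitrary: n) (auto simp: box_sum_def intro!: sum_nonneg)

text \<open>A window of length \<open>2 * N\<close> starting in one block of length \<open>N\<close>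
  covers the whole next block to the right, where the previous sum is already large; positivity
  allows the rest to be dropped. Each further iteration therefore gains a factor
  \<open>N\<close>.\<close>

lemma box_sum_funpow_lower_bound:
  fixes F :: "int \<Rightarrow> real"
  assumes S: "S \<subseteq> {M + 1..M + int N}" and F: "\<And>n. F n \<ge> 0" and q: "\<And>n. n \<in> S \<Longrightarrow> F n \<ge> q"
    and n: "n \<in> {M + 1 - int ((k + 1) * N)..M + 1 - int (k * N)}"
  shows "real (card S) * q * real N ^ k \<le> (box_sum (2 * N) ^^ Suc k) F n"
  using n
proof (induction k arbitrary: n)
  case 0
  have "real (card S) * q \<le> (\<Sum>x\<in>S. F x)"
    using sum_mono[of S "\<lambda>_. q" F] q by simp
  also have "\<dots> \<le> (\<Sum>x\<in>{n..<n + int (2 * N)}. F x)"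
    using S 0 F by (intro sum_mono2) auto
  finally show ?case by (simp add: box_sum_eq)
next
  case (Suc k)
  define c where "c = real (card S) * q * real N ^ k"
  define lo where "lo = M + 1 - int ((k + 1) * N)"
  have lo: "lo + int N = M + 1 - int (k * N)" "lo - int N = M + 1 - int ((Suc k + 1) * N)"
    by (simp_all add: lo_def algebra_simps)
  have n: "lo - int N \<le> n" "n \<le> lo" using Suc.prems unfolding lo(2) by (simp_all add: lo_def)
  have "c * real N = (\<Sum>x\<in>{lo..<lo + int N}. c)" by simp
  also have "\<dots> \<le> (\<Sum>x\<in>{lo..<lo + int N}. (box_sum (2 * N) ^^ Suc k) F x)"
    unfolding c_def using lo(1) by (intro sum_mono Suc.IH) (auto simp: lo_def)
  also have "\<dots> \<le> (\<Sum>x\<in>{n..<n + int (2 * N)}. (box_sum (2 * N) ^^ Suc k) F x)"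
    using n by (intro sum_mono2 box_sum_funpow_nonneg F) auto
  finally show ?case
    by (simp only: funpow.simps(2)[of "Suc k"] o_apply box_sum_eq[of _ "(box_sum (2 * N) ^^ Suc k) F"])
       (simp add: c_def mult_ac)
qed

section \<open>Cancellation over cosets and the resulting sieve\<close>

text \<open>Multiplication by \<open>c\<close> permutes the residues modulo \<open>r\<close>, and
  \<open>F\<close> has period \<open>m * r\<close>, so steps of length \<open>m * c\<close> visit
  the same coset as steps of length \<open>m\<close>.\<close>

lemma coset_sum_shift:
  fixes F :: "int \<Rightarrow> real"
  assumes r: "prime r" and per: "\<And>n. F (n + int (m * r)) = F n"
    and coset: "\<And>n. (\<Sum>j<r. F (n + int (j * m))) = 0" and c: "\<not> r dvd c"
  shows "(\<Sum>j<r. F (n + int (j * (m * c)))) = 0"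
proof -
  have per': "F (n + int (q * (m * r))) = F n" for n q
  proof (induction q)
    case (Suc q)
    then show ?case using per[of "n + int (q * (m * r))"] by (simp add: algebra_simps)
  qed simp
  have cop: "coprime c r" using r c by (metis coprime_commute prime_imp_coprime)
  have inj: "inj_on (\<lambda>j. j * c mod r) {..<r}"
  proof (rule inj_onI)
    fix x y assume "x \<in> {..<r}" "y \<in> {..<r}" "x * c mod r = y * c mod r"
    then have "[x * c = y * c] (mod r)" unfolding unique_euclidean_semiring_class.cong_def by simp
    then have "[x = y] (mod r)" using cong_mult_rcancel_nat[OF cop] by blast
    then show "x = y" using \<open>x \<in> {..<r}\<close> \<open>y \<in> {..<r}\<close> by (simp add: cong_less_modulus_unique_nat)
  qed
  have bij: "bij_betw (\<lambda>j. j * c mod r) {..<r} {..<r}"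
    using prime_gt_0_nat[OF r] by (intro bij_betw_imageI inj endo_inj_surj) auto
  have "(\<Sum>j<r. F (n + int (j * (m * c)))) = (\<Sum>j<r. F (n + int ((j * c mod r) * m)))"
  proof (rule sum.cong)
    fix j
    have "j * (m * c) = (j * c mod r) * m + (j * c div r) * (m * r)"
      by (metis (no_types, lifting) add.commute add_mult_distrib div_mult_mod_eq mult.assoc mult.commute)
    then show "F (n + int (j * (m * c))) = F (n + int ((j * c mod r) * m))"
      using per'[of "n + int ((j * c mod r) * m)" "j * c div r"] by (simp add: add.assoc)
  qed simp
  also have "\<dots> = (\<Sum>j<r. F (n + int (j * m)))"
    by (rule sum.reindex_bij_betw[OF bij])
  finally show ?thesis using coset by simp
qed

text \<open>Translating by multiples of \<open>m c\<close> fixes \<open>G\<close> and moves \<open>F\<close> through a full coset.\<close>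

lemma box_sum_product_mean_zero:
  fixes F G :: "int \<Rightarrow> real"
  assumes r: "prime r" and perF: "\<And>n. F (n + int (m * r)) = F n"
    and coset: "\<And>n. (\<Sum>j<r. F (n + int (j * m))) = 0"
    and perG: "\<And>n. G (n + int c) = G n" and c: "\<not> r dvd c"
  shows "box_sum (m * r * c) (\<lambda>n. F n * G n) n = 0"
proof -
  define T where "T = m * r * c"
  define P where "P n = F n * G n" for n
  have perF': "F (n + int (q * (m * r))) = F n" for n q
  proof (induction q)
    case (Suc q)
    then show ?case using perF[of "n + int (q * (m * r))"] by (simp add: algebra_simps)
  qed simp
  have perG': "G (n + int (q * c)) = G n" for n q
  proof (induction q)
    case (Suc q)
    then show ?case using perG[of "n + int (q * c)"] by (simp add: algebra_simps)
  qed simp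
  have perP: "P (n + int T) = P n" for n
    using perF'[of n c] perG'[of n "m * r"] by (simp add: P_def T_def mult_ac)
  note shift = box_sum_periodic[where F = P, OF perP]
  \<comment> \<open>A sum over a period is the same from every starting point, so it equals its
    average over \<open>r\<close> shifts by multiples of \<open>m * c\<close>; for each fixed
    summand these shifts add up to zero.\<close>
  have "real r * box_sum T P n = (\<Sum>j<r. box_sum T P (n + int (j * (m * c))))"
    by (simp only: shift) simp
  also have "\<dots> = (\<Sum>a<T. \<Sum>j<r. P (n + int a + int (j * (m * c))))"
    unfolding box_sum_def by (subst sum.swap) (simp add: ac_simps)
  also have "\<dots> = (\<Sum>a<T. G (n + int a) * (\<Sum>j<r. F (n + int a + int (j * (m * c)))))"
  proof -
    have "G (n + int a + int (j * (m * c))) = G (n + int a)" for a j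
      using perG'[of "n + int a" "j * m"] by (simp add: mult.assoc)
    then show ?thesis by (simp add: P_def sum_distrib_left mult.commute)
  qed
  also have "\<dots> = 0" using coset_sum_shift[OF r perF coset c] by simp
  finally show ?thesis using prime_gt_0_nat[OF r] by (simp add: T_def P_def[abs_def])
qed

lemma card_multiples_le:
  fixes w :: "'a \<Rightarrow> nat"
  assumes "finite A" "inj_on w A" "r > 0" and w: "\<And>x. x \<in> A \<Longrightarrow> 0 < w x \<and> w x \<le> z"
  shows "card {x \<in> A. r dvd w x} \<le> z div r"
proof -
  have "card {x \<in> A. r dvd w x} = card ((\<lambda>x. w x div r) ` {x \<in> A. r dvd w x})"
  proof (rule card_image[symmetric], rule inj_onI)
    fix x y assume "x \<in> {x \<in> A. r dvd w x}" "y \<in> {x \<in> A. r dvd w x}" "w x div r = w y div r"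
    then have "w x = w y" by (metis (mono_tags, lifting) dvd_div_mult_self mem_Collect_eq)
    then show "x = y" using assms(2) \<open>x \<in> _\<close> \<open>y \<in> _\<close> by (auto dest: inj_onD)
  qed
  also have "\<dots> \<le> card {1..z div r}"
  proof (rule card_mono)
    show "(\<lambda>x. w x div r) ` {x \<in> A. r dvd w x} \<subseteq> {1..z div r}"
      using w \<open>r > 0\<close> by (auto simp: div_le_mono dvd_div_eq_0_iff Suc_le_eq dvd_imp_le div_greater_zero_iff)
  qed simp
  finally show ?thesis by simp
qed

text \<open>The square of the sum of all \<open>H x\<close> is box-summed \<open>Suc k\<close>
  times; on \<open>S\<close> it is at least \<open>(card A / 4)^2\<close>. After expansion, a pair
  for which \<open>r x\<close> does not divide the period of the other function has a product of
  mean zero and costs at most \<open>z^2\<close> per iteration. The other pairs, at most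
  \<open>z / R\<close> for each \<open>x\<close>, are bounded trivially.\<close>

theorem coset_sieve:
  fixes H :: "'a \<Rightarrow> int \<Rightarrow> real"
  assumes A: "finite A" and r: "\<And>x. x \<in> A \<Longrightarrow> prime (r x)"
    and per: "\<And>x n. x \<in> A \<Longrightarrow> H x (n + int (m x * r x)) = H x n"
    and coset: "\<And>x n. x \<in> A \<Longrightarrow> (\<Sum>j<r x. H x (n + int (j * m x))) = 0"
    and le1: "\<And>x n. x \<in> A \<Longrightarrow> \<bar>H x n\<bar> \<le> 1"
    and inj: "inj_on (\<lambda>x. m x * r x) A"
    and z: "\<And>x. x \<in> A \<Longrightarrow> 0 < m x * r x \<and> m x * r x \<le> z"
    and R: "R > 0" "\<And>x. x \<in> A \<Longrightarrow> R \<le> real (r x)"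
    and S: "S \<subseteq> {M + 1..M + int N}"
    and large: "\<And>n x. n \<in> S \<Longrightarrow> x \<in> A \<Longrightarrow> H x n \<ge> 1 / 4"
  shows "real (card S) * (real (card A) / 4)\<^sup>2 * real N ^ k
    \<le> (real (card A))\<^sup>2 * (real z ^ 2) ^ Suc k + real (card A) * (real z / R) * (2 * real N) ^ Suc k"
proof -
  define B where "B = (box_sum (2 * N) ^^ Suc k)"
  define Y where "Y n = (\<Sum>x\<in>A. H x n)" for n
  define n0 where "n0 = M + 1 - int (k * N)"
  define bad where "bad = (\<lambda>x. {y \<in> A. r x dvd m y * r y})"
  have Y2: "(\<lambda>n. (Y n)\<^sup>2) = (\<lambda>n. \<Sum>t\<in>A \<times> A. H (fst t) n * H (snd t) n)"
    by (simp add: Y_def power2_eq_square sum_product sum.cartesian_product case_prod_unfold)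
  have "real (card S) * (real (card A) / 4)\<^sup>2 * real N ^ k \<le> B (\<lambda>n. (Y n)\<^sup>2) n0"
    unfolding B_def
  proof (rule box_sum_funpow_lower_bound[OF S])
    fix n assume "n \<in> S"
    then have "(\<Sum>x\<in>A. 1 / 4) \<le> Y n" unfolding Y_def by (intro sum_mono large)
    then show "(real (card A) / 4)\<^sup>2 \<le> (Y n)\<^sup>2" by (intro power_mono) auto
  qed (auto simp: n0_def algebra_simps)
  also have "\<dots> = (\<Sum>t\<in>A \<times> A. B (\<lambda>n. H (fst t) n * H (snd t) n) n0)"
    unfolding Y2 B_def by (rule box_sum_funpow_sum)
  also have "\<dots> \<le> (\<Sum>t\<in>A \<times> A. (real z ^ 2) ^ Suc k + (if snd t \<in> bad (fst t) then (2 * real N) ^ Suc k else 0))"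
  proof (rule sum_mono)
    fix t assume "t \<in> A \<times> A"
    then have t: "fst t \<in> A" "snd t \<in> A" by auto
    have le: "\<bar>H (fst t) n * H (snd t) n\<bar> \<le> 1" for n
      using mult_mono[OF le1[OF t(1), of n] le1[OF t(2), of n]] by (simp add: abs_mult)
    show "B (\<lambda>n. H (fst t) n * H (snd t) n) n0 \<le> (real z ^ 2) ^ Suc k + (if snd t \<in> bad (fst t) then (2 * real N) ^ Suc k else 0)"
    proof (cases "snd t \<in> bad (fst t)")
      case True
      have "\<bar>B (\<lambda>n. H (fst t) n * H (snd t) n) n0\<bar> \<le> real (2 * N) ^ Suc k * 1"
        unfolding B_def by (rule box_sum_funpow_abs_le) (rule le)
      then have "B (\<lambda>n. H (fst t) n * H (snd t) n) n0 \<le> (2 * real N) ^ Suc k"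
        by (simp only: of_nat_mult of_nat_numeral mult_1_right abs_le_iff)
      moreover have "0 \<le> (real z ^ 2) ^ Suc k" by simp
      ultimately show ?thesis unfolding if_P[OF True] by linarith
    next
      case False
      then have nd: "\<not> r (fst t) dvd m (snd t) * r (snd t)" using t by (simp add: bad_def)
      define T where "T = m (fst t) * r (fst t) * (m (snd t) * r (snd t))"
      have "\<bar>B (\<lambda>n. H (fst t) n * H (snd t) n) n0\<bar> \<le> real T ^ Suc k * 1"
        unfolding B_def T_def
        using z[OF t(1)] z[OF t(2)]
        by (intro box_sum_funpow_mean_zero_bound[OF _ box_sum_product_mean_zero[where F = "H (fst t)" and G = "H (snd t)" and c = "m (snd t) * r (snd t)", OF r[OF t(1)] per[OF t(1)] coset[OF t(1)] per[OF t(2)] nd] le]) auto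
      also have "real T \<le> real z ^ 2"
      proof -
        have "T \<le> z * z" unfolding T_def using z[OF t(1)] z[OF t(2)] by (intro mult_le_mono) auto
        then show ?thesis by (simp add: power2_eq_square flip: of_nat_mult)
      qed
      then have "real T ^ Suc k * 1 \<le> (real z ^ 2) ^ Suc k" by (simp only: mult_1_right) (rule power_mono, auto)
      finally show ?thesis using False by simp
    qed
  qed
  also have "\<dots> = (real (card A))\<^sup>2 * (real z ^ 2) ^ Suc k + (\<Sum>x\<in>A. real (card (bad x)) * (2 * real N) ^ Suc k)"
  proof -
    have "(\<Sum>t\<in>A \<times> A. if snd t \<in> bad (fst t) then (2 * real N) ^ Suc k else 0)
       = (\<Sum>x\<in>A. \<Sum>y\<in>A. if y \<in> bad x then (2 * real N) ^ Suc k else 0)"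
      by (simp add: sum.cartesian_product case_prod_unfold)
    also have "\<dots> = (\<Sum>x\<in>A. real (card (bad x)) * (2 * real N) ^ Suc k)"
    proof (rule sum.cong)
      fix x
      have "(\<Sum>y\<in>A. if y \<in> bad x then (2 * real N) ^ Suc k else 0) = (\<Sum>y\<in>A \<inter> bad x. (2 * real N) ^ Suc k)"
        by (rule sum.inter_restrict[OF A, symmetric])
      also have "A \<inter> bad x = bad x" by (auto simp: bad_def)
      finally show "(\<Sum>y\<in>A. if y \<in> bad x then (2 * real N) ^ Suc k else 0) = real (card (bad x)) * (2 * real N) ^ Suc k"
        by simp
    qed simp
    finally show ?thesis by (simp add: sum.distrib card_cartesian_product power2_eq_square)
  qed
  also have "(\<Sum>x\<in>A. real (card (bad x)) * (2 * real N) ^ Suc k) \<le> (\<Sum>x\<in>A. (real z / R) * (2 * real N) ^ Suc k)"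
  proof (rule sum_mono)
    fix x assume x: "x \<in> A"
    have "card (bad x) \<le> z div r x"
      unfolding bad_def using A inj z prime_gt_0_nat[OF r[OF x]] by (intro card_multiples_le) auto
    then have "real (card (bad x)) \<le> real (z div r x)" by simp
    also have "\<dots> \<le> real z / real (r x)" by (rule of_nat_div_le_of_nat)
    also have "\<dots> \<le> real z / R" using R(2)[OF x] order_less_le_trans[OF R(1) R(2)[OF x]] R(1)
      by (intro divide_left_mono mult_pos_pos) auto
    finally show "real (card (bad x)) * (2 * real N) ^ Suc k \<le> (real z / R) * (2 * real N) ^ Suc k"
      by (intro mult_right_mono) auto
  qed
  finally show ?thesis by (simp add: mult_ac)
qed

section \<open>Subtraction of coset averages\<close>

definition coset_balanced :: "nat \<Rightarrow> nat \<Rightarrow> (int \<Rightarrow> real) \<Rightarrow> int \<Rightarrow> real" where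
  "coset_balanced m r F n = F n - (\<Sum>j<r. F (n + int (j * m))) / real r"

lemma coset_balanced_periodic:
  assumes "\<And>n. F (n + int (m * r)) = F n"
  shows "coset_balanced m r F (n + int (m * r)) = coset_balanced m r F n"
proof -
  have "F (n + int (m * r) + int (j * m)) = F (n + int (j * m))" for j
    using assms[of "n + int (j * m)"] by (simp add: ac_simps)
  then show ?thesis using assms[of n] by (simp add: coset_balanced_def)
qed

lemma coset_balanced_sum:
  assumes per: "\<And>n. F (n + int (m * r)) = F n" and r: "r > 0"
  shows "(\<Sum>j<r. coset_balanced m r F (n + int (j * m))) = 0"
proof -
  \<comment> \<open>\<open>E\<close> reads \<open>F\<close> along the progression of step
    \<open>m\<close>, where it has period \<open>r\<close>; hence the average subtracted at
    \<open>n + j m\<close> does not depend on \<open>j\<close>.\<close>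
  define E where "E q = F (n + q * int m)" for q
  have "E (q + int r) = E q" for q
    using per[of "n + q * int m"] by (simp add: E_def algebra_simps)
  note shift = box_sum_periodic[of E r, OF this]
  have "(\<Sum>i<r. F (n + int (j * m) + int (i * m))) = (\<Sum>i<r. F (n + int (i * m)))" for j
    using shift[of 0 j] by (simp add: box_sum_def E_def algebra_simps)
  then show ?thesis using r
    by (simp add: coset_balanced_def sum_subtractf sum_divide_distrib[symmetric])
qed

lemma coset_balanced_abs_le:
  assumes F: "\<And>n. 0 \<le> F n \<and> F n \<le> 1"
  shows "\<bar>coset_balanced m r F n\<bar> \<le> 1"
proof -
  have "0 \<le> (\<Sum>j<r. F (n + int (j * m)))" using F by (intro sum_nonneg) auto
  moreover have "(\<Sum>j<r. F (n + int (j * m))) \<le> (\<Sum>j<r. 1)" using F by (intro sum_mono) auto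
  ultimately have "0 \<le> (\<Sum>j<r. F (n + int (j * m))) / real r" "(\<Sum>j<r. F (n + int (j * m))) / real r \<le> 1"
    by (auto simp: divide_le_eq_1)
  then show ?thesis using F[of n] unfolding coset_balanced_def by linarith
qed

section \<open>Quadratic characters of polynomial values\<close>

text \<open>Suppose \<open>p\<close> does not divide \<open>y\<close>. If \<open>p\<close> divided
  the squarefree \<open>s\<close>, it would divide \<open>s y\<close> exactly once, impossible for a
  square. So \<open>s\<close>, \<open>y\<close>, \<open>w\<close> are units modulo \<open>p\<close>,
  and Fermat gives \<open>s^e y^e = w^(2e) = 1\<close> and \<open>s^(2e) = 1\<close>.\<close>

lemma squarefree_times_square_residue:
  fixes s y w :: int
  assumes p: "prime p" "p = 2 * e + 1" and s: "squarefree s" and eq: "s * y = w\<^sup>2"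
  shows "int p dvd y \<or> [y ^ e = s ^ e] (mod int p)"
proof (cases "int p dvd y")
  case False
  have pp: "prime (int p)" using p(1) by simp
  have ns: "\<not> int p dvd s"
  proof
    assume ps: "int p dvd s"
    then obtain t where t: "s = int p * t" by (rule dvdE)
    have "int p dvd w\<^sup>2" unfolding eq[symmetric] using ps by simp
    then have "int p dvd w" using pp prime_dvd_power by blast
    then obtain v where v: "w = int p * v" by (rule dvdE)
    have "int p * (t * y) = int p * (int p * v\<^sup>2)"
      using eq unfolding t v by (simp add: power2_eq_square mult_ac)
    then have "t * y = int p * v\<^sup>2" using prime_gt_0_nat[OF p(1)] by simp
    then have "int p dvd t * y" by simp
    then have "int p dvd t" using False pp prime_dvd_mult_iff by blast
    then have "(int p)\<^sup>2 dvd s" unfolding t power2_eq_square by (intro mult_dvd_mono) auto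
    then have "is_unit (int p)" using s by (auto simp: squarefree_def)
    then show False using pp not_prime_unit by blast
  qed
  have nw: "\<not> int p dvd w"
  proof
    assume "int p dvd w"
    then have "int p dvd s * y" unfolding eq by (simp add: power2_eq_square)
    then show False using ns False pp prime_dvd_mult_iff by blast
  qed
  have fermat: "[x ^ (2 * e) = 1] (mod int p)" if "\<not> int p dvd x" for x
    using fermat_theorem_int[OF p(1) that] p(2) by simp
  have "[y ^ e * (s ^ e * s ^ e) = y ^ e * 1] (mod int p)"
    using fermat[OF ns] by (intro cong_scalar_left) (simp add: mult_2 power_add)
  moreover have "w ^ (2 * e) = y ^ e * s ^ e"
    unfolding power_mult eq[symmetric] by (simp add: power_mult_distrib)
  then have "[(y ^ e * s ^ e) * s ^ e = 1 * s ^ e] (mod int p)"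
    using fermat[OF nw] by (intro cong_scalar_right) simp
  ultimately show ?thesis
    by (metis cong_sym cong_trans mult.assoc mult.commute mult_1)
qed simp

text \<open>By Fermat the order of \<open>g^m\<close> divides the prime \<open>r\<close>; it is not
  1, so the \<open>r\<close> powers are distinct.\<close>

lemma coset_power_inj:
  fixes g p m r :: nat
  assumes p: "prime p" and r: "prime r" and pm: "p = m * r + 1" and g: "\<not> p dvd g"
    and gm: "\<not> [g ^ m = 1] (mod p)"
  shows "inj_on (\<lambda>j. int g ^ (n + j * m) mod int p) {..<r}"
proof -
  have cop: "coprime g p" using p g by (metis coprime_commute prime_imp_coprime)
  have "[g ^ (m * r) = 1] (mod p)" using fermat_theorem[OF p g] pm by simp
  then have 1: "ord p (g ^ m) dvd r" by (simp add: power_mult flip: ord_divides)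
  have False if ij: "i < j" "j < r" and eq: "int g ^ (n + i * m) mod int p = int g ^ (n + j * m) mod int p" for i j
  proof -
    have "g ^ (n + i * m) mod p = g ^ (n + j * m) mod p"
      using eq by (metis of_nat_eq_iff of_nat_mod of_nat_power)
    moreover obtain d where "j = i + d" using ij(1) less_imp_add_positive by blast
    then have "n + j * m = n + i * m + (j - i) * m" by (simp add: algebra_simps)
    ultimately have "[g ^ (n + i * m) * 1 = g ^ (n + i * m) * g ^ ((j - i) * m)] (mod p)"
      unfolding unique_euclidean_semiring_class.cong_def by (simp add: power_add)
    moreover have "coprime (g ^ (n + i * m)) p" using cop by simp
    ultimately have "[1 = g ^ ((j - i) * m)] (mod p)"
      using cong_mult_lcancel_nat by blast
    then have "[(g ^ m) ^ (j - i) = 1] (mod p)" by (simp add: cong_sym_eq mult.commute flip: power_mult)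
    then have "ord p (g ^ m) dvd j - i" using ord_divides by blast
    moreover have "\<not> r dvd j - i" using ij by (intro nat_dvd_not_less) auto
    then have "coprime (j - i) r" using r by (metis coprime_commute prime_imp_coprime)
    ultimately have "ord p (g ^ m) dvd 1" using 1 by (metis coprime_common_divisor is_unit_gcd)
    then have "[(g ^ m) ^ 1 = 1] (mod p)" using ord_divides by blast
    then show False using gm by simp
  qed
  then show ?thesis by (intro inj_onI) (metis lessThan_iff linorder_neqE_nat)
qed

lemma card_roots_mod:
  assumes p: "prime p" and f: "\<not> int p dvd lead_coeff f"
  shows "card {x \<in> {0..<int p}. int p dvd poly f x} \<le> degree f"
proof -
  have "1 * card {x \<in> {0..<int p}. int p dvd poly f x} \<le> degree f"
  proof (rule multiple_roots_mod_bound)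
    show "prime (int p)" using p by simp
    show "finite {x \<in> {0..<int p}. int p dvd poly f x}"
      by (rule finite_subset[of _ "{0..<int p}"]) auto
    show "\<not> [:int p:] dvd f" using f by (auto simp: const_poly_dvd_iff)
    show "\<exists>Q. [:int p:] dvd f - [:- x, 1:] ^ 1 * Q" if "x \<in> {x \<in> {0..<int p}. int p dvd poly f x}" for x
      using root_imp_linear_factor_mod[of "int p" f x] that by auto
    show "x = y" if "x \<in> {x \<in> {0..<int p}. int p dvd poly f x}" "y \<in> {x \<in> {0..<int p}. int p dvd poly f x}"
      "int p dvd x - y" for x y
    proof -
      have "x mod int p = y mod int p" using that(3) by (simp add: mod_eq_dvd_iff)
      then show ?thesis using that(1,2) by simp
    qed
  qed
  then show ?thesis by simp
qed

lemma poly_mod_cong: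
  fixes f :: "int poly"
  assumes "[x = y] (mod n)"
  shows "[poly f x = poly f y] (mod n)"
  by (induction f) (auto intro!: cong_add cong_mult assms)

text \<open>Residues \<open>x\<close> for which \<open>f x\<close> can be \<open>s\<close> times a square, where \<open>a = s\<^bsup>e\<^esup>\<close>.\<close>

definition admissible :: "nat \<Rightarrow> int poly \<Rightarrow> int \<Rightarrow> int \<Rightarrow> bool" where
  "admissible p f a x \<longleftrightarrow> int p dvd poly f x \<or> [poly f x ^ ((p - 1) div 2) = a] (mod int p)"

lemma admissible_cong:
  assumes "[x = y] (mod int p)"
  shows "admissible p f a x \<longleftrightarrow> admissible p f a y"
proof -
  have "[poly f x = poly f y] (mod int p)" by (rule poly_mod_cong[OF assms])
  then show ?thesis unfolding admissible_def
    by (metis cong_dvd_iff cong_pow cong_sym cong_trans)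
qed

text \<open>On a coset of the subgroup of odd order \<open>r\<close> the quadratic character of \<open>x\<close> is constant, so
  powers of \<open>x\<close> dividing \<open>f\<close> do no harm.\<close>

lemma admissible_coset_bound:
  fixes f f1 :: "int poly" and g :: nat
  assumes p: "prime p" and r: "prime r" and pm: "p = m * r + 1" and m: "m \<ge> 1" "even m"
    and bezout: "U * f1 + V * pderiv f1 = [:R:]" "\<not> int p dvd R"
    and f1: "\<not> int p dvd lead_coeff f1" "degree f1 \<ge> 1" "\<not> int p dvd poly f1 0"
    and f: "f = monom 1 i * f1"
    and big: "33 * (degree f1)\<^sup>2 * m < r"
    and g: "\<not> p dvd g" and gm: "\<not> [g ^ m = 1] (mod p)"
  shows "4 * card {j \<in> {..<r}. admissible p f a (int g ^ (n + j * m))} \<le> 3 * r"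
proof -
  define e where "e = (p - 1) div 2"
  have pp: "prime (int p)" using p by simp
  \<comment> \<open>\<open>C\<close> and \<open>D\<close> are the constant values of
    \<open>x^r\<close> and \<open>x^e\<close> on the coset. \<open>D\<close> is a value of the
    quadratic character, so its square is 1.\<close>
  define C where "C = int g ^ (n * r)"
  define D where "D = C ^ (m div 2)"
  have ng: "\<not> int p dvd int g" using g by simp
  have ngk: "\<not> int p dvd int g ^ k" for k using ng pp prime_dvd_power by blast
  have fermat: "[int g ^ (m * r * k) = 1] (mod int p)" for k
  proof -
    have "[(int g ^ (m * r)) ^ k = 1 ^ k] (mod int p)"
      using fermat_theorem_int[OF p ng] pm by (intro cong_pow) simp
    then show ?thesis by (simp add: power_mult)
  qed
  have D2: "[D * D = 1] (mod int p)"
  proof -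
    have "m div 2 + m div 2 = m" using m(2) by presburger
    then have "D * D = C ^ m" by (simp add: D_def flip: power_add)
    also have "\<dots> = int g ^ (m * r * n)" by (simp add: C_def mult_ac flip: power_mult)
    finally show ?thesis using fermat by simp
  qed
  \<comment> \<open>Since \<open>f = X^i f1\<close> and \<open>D^2 = 1\<close>, away from the zeros
    of \<open>f1\<close> the condition \<open>f(x)^e = a\<close> becomes
    \<open>f1(x)^e = D^i a\<close> on the coset.\<close>
  define a' where "a' = D ^ i * a"
  define Z where "Z = {x \<in> {0..<int p}. [x ^ r = C] (mod int p) \<and> \<not> int p dvd poly f1 x \<and>
      [poly f1 x ^ e = a'] (mod int p)}"
  define Z0 where "Z0 = {x \<in> {0..<int p}. int p dvd poly f1 x}"
  have fin: "finite Z" "finite Z0"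
    by (rule finite_subset[of _ "{0..<int p}"]; auto simp: Z_def Z0_def)+
  have "16 * card Z \<le> 11 * r"
    unfolding Z_def e_def
    by (rule stepanov_coset_bound[OF p pm m(1) _ bezout f1 _ big]) (use m ngk in \<open>auto simp: C_def\<close>)
  have "card Z0 \<le> degree f1" unfolding Z0_def by (rule card_roots_mod[OF p f1(1)])
  have "card {j \<in> {..<r}. admissible p f a (int g ^ (n + j * m))}
      = card ((\<lambda>j. int g ^ (n + j * m) mod int p) ` {j \<in> {..<r}. admissible p f a (int g ^ (n + j * m))})"
    by (rule card_image[symmetric], rule inj_on_subset[OF coset_power_inj[OF p r pm g gm]]) auto
  also have "\<dots> \<le> card (Z \<union> Z0)"
  proof (rule card_mono)
    show "(\<lambda>j. int g ^ (n + j * m) mod int p) ` {j \<in> {..<r}. admissible p f a (int g ^ (n + j * m))} \<subseteq> Z \<union> Z0"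
    proof (rule image_subsetI)
      fix j assume "j \<in> {j \<in> {..<r}. admissible p f a (int g ^ (n + j * m))}"
      then have adm: "admissible p f a (int g ^ (n + j * m))" by simp
      define x where "x = int g ^ (n + j * m) mod int p"
      have x: "[x = int g ^ (n + j * m)] (mod int p)" by (simp add: x_def)
      have x01: "x \<in> {0..<int p}" using prime_gt_0_nat[OF p] by (simp add: x_def)
      have nx: "\<not> int p dvd x" using ngk cong_dvd_iff[OF x] by simp
      have "[x ^ r = (int g ^ (n + j * m)) ^ r] (mod int p)" by (rule cong_pow[OF x])
      also have "(int g ^ (n + j * m)) ^ r = C * int g ^ (m * r * j)"
        by (simp add: C_def algebra_simps flip: power_mult power_add)
      also have "[\<dots> = C * 1] (mod int p)" by (rule cong_scalar_left[OF fermat])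
      finally have xr: "[x ^ r = C] (mod int p)" by simp
      have "2 * e = 2 * (r * (m div 2))" using m(2) pm by (simp add: e_def mult_ac)
      then have "x ^ e = (x ^ r) ^ (m div 2)" by (simp flip: power_mult)
      then have xe: "[x ^ e = D] (mod int p)" unfolding D_def using cong_pow[OF xr] by simp
      have fx: "poly f x = x ^ i * poly f1 x" by (simp add: f poly_monom)
      have "x \<in> Z \<union> Z0"
      proof (cases "int p dvd poly f1 x")
        case True
        then show ?thesis using x01 by (simp add: Z0_def)
      next
        case False
        then have "\<not> int p dvd poly f x"
          unfolding fx using pp nx prime_dvd_mult_iff prime_dvd_power by blast
        moreover have "admissible p f a x" using adm admissible_cong[OF x] by blast
        ultimately have "[poly f x ^ e = a] (mod int p)" by (simp add: admissible_def e_def)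
        moreover have "poly f x ^ e = (x ^ e) ^ i * poly f1 x ^ e"
          by (simp add: fx power_mult_distrib mult.commute flip: power_mult)
        then have "[poly f x ^ e = D ^ i * poly f1 x ^ e] (mod int p)"
          using cong_scalar_right[OF cong_pow[OF xe, of i]] by metis
        ultimately have "[D ^ i * poly f1 x ^ e = a] (mod int p)" by (metis cong_sym cong_trans)
        then have "[D ^ i * (D ^ i * poly f1 x ^ e) = a'] (mod int p)"
          unfolding a'_def by (rule cong_scalar_left)
        moreover have "[D ^ i * D ^ i * poly f1 x ^ e = 1 ^ i * poly f1 x ^ e] (mod int p)"
          unfolding power_mult_distrib[symmetric] by (intro cong_scalar_right cong_pow D2)
        ultimately have "[poly f1 x ^ e = a'] (mod int p)"
          by (metis cong_sym cong_trans mult.assoc mult_1 power_one)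
        then show ?thesis using x01 xr False by (simp add: Z_def)
      qed
      then show "int g ^ (n + j * m) mod int p \<in> Z \<union> Z0" by (simp add: x_def)
    qed
  qed (use fin in simp)
  also have "\<dots> \<le> card Z + card Z0" by (rule card_Un_le)
  finally have "card {j \<in> {..<r}. admissible p f a (int g ^ (n + j * m))} \<le> card Z + card Z0" .
  \<comment> \<open>The zeros of \<open>f1\<close> add at most \<open>r / 16\<close>, which raises
    the proportion from 11/16 to 3/4.\<close>
  moreover have "16 * degree f1 \<le> r"
  proof -
    have "degree f1 * 1 * 1 \<le> degree f1 * degree f1 * m"
      using f1(2) m(1) by (intro mult_le_mono) auto
    then have "degree f1 \<le> (degree f1)\<^sup>2 * m" by (simp only: power2_eq_square mult_1_right)
    moreover have "33 * ((degree f1)\<^sup>2 * m) < r" using big by (simp only: mult.assoc)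
    ultimately show ?thesis by linarith
  qed
  ultimately show ?thesis using \<open>16 * card Z \<le> 11 * r\<close> \<open>card Z0 \<le> degree f1\<close> by linarith
qed

text \<open>The averaging windows may reach negative \<open>n\<close>, where \<open>nat\<close>
  alone would freeze the exponent at 0. Reducing modulo \<open>p - 1\<close> gives a function
  periodic on all integers, which by Fermat is the intended one for \<open>n \<ge> 0\<close> if
  \<open>p\<close> does not divide \<open>g\<close>.\<close>

definition admissible_at :: "nat \<Rightarrow> int poly \<Rightarrow> int \<Rightarrow> nat \<Rightarrow> int \<Rightarrow> real" where
  "admissible_at p f a g n = of_bool (admissible p f a (int g ^ nat (n mod int (p - 1))))"

lemma admissible_at_periodic: "admissible_at p f a g (n + int (p - 1)) = admissible_at p f a g n"
  by (simp add: admissible_at_def)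

lemma power_mod_fermat:
  assumes p: "prime p" and g: "\<not> int p dvd g" and n: "n \<ge> 0"
  shows "[g ^ nat (n mod int (p - 1)) = g ^ nat n] (mod int p)"
proof -
  define q where "q = nat n div (p - 1)"
  have "nat n = nat n mod (p - 1) + (p - 1) * q" by (simp add: q_def)
  moreover have "nat (n mod int (p - 1)) = nat n mod (p - 1)" using n by (simp add: nat_mod_distrib)
  ultimately have "g ^ nat n = g ^ nat (n mod int (p - 1)) * (g ^ (p - 1)) ^ q"
    by (metis power_add power_mult)
  moreover have "[(g ^ (p - 1)) ^ q = 1 ^ q] (mod int p)"
    using fermat_theorem_int[OF p g] by (rule cong_pow)
  ultimately show ?thesis
    by (metis cong_scalar_left cong_sym mult.right_neutral power_one)
qed

lemma admissible_at_eq: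
  assumes "prime p" "\<not> p dvd g" "n \<ge> 0"
  shows "admissible_at p f a g n = of_bool (admissible p f a (int g ^ nat n))"
  using power_mod_fermat[of p "int g" n] assms admissible_cong by (simp add: admissible_at_def)

text \<open>The indicator is 1 at \<open>n\<close>, while its coset average is at most 3/4.\<close>

lemma admissible_at_balanced:
  fixes f f1 :: "int poly" and g :: nat
  assumes p: "prime p" and r: "prime r" and pm: "p = m * r + 1" and m: "m \<ge> 1" "even m"
    and bezout: "U * f1 + V * pderiv f1 = [:R:]" "\<not> int p dvd R"
    and f1: "\<not> int p dvd lead_coeff f1" "degree f1 \<ge> 1" "\<not> int p dvd poly f1 0"
    and f: "f = monom 1 i * f1"
    and big: "33 * (degree f1)\<^sup>2 * m < r"
    and g: "\<not> p dvd g" and gm: "\<not> [g ^ m = 1] (mod p)"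
    and n: "admissible_at p f a g n = 1"
  shows "coset_balanced m r (admissible_at p f a g) n \<ge> 1 / 4"
proof -
  have r0: "r > 0" using r by (rule prime_gt_0_nat)
  have mr: "int (p - 1) > 0" using pm m r0 by simp
  define k where "k = nat (n mod int (p - 1))"
  have k: "int k = n mod int (p - 1)" using mr by (simp add: k_def)
  have "admissible_at p f a g (n + int (j * m)) = of_bool (admissible p f a (int g ^ (k + j * m)))" for j
  proof -
    have "(n + int (j * m)) mod int (p - 1) = int (k + j * m) mod int (p - 1)"
      by (simp add: k mod_simps)
    then have "admissible_at p f a g (n + int (j * m)) = admissible_at p f a g (int (k + j * m))"
      by (simp add: admissible_at_def)
    also have "\<dots> = of_bool (admissible p f a (int g ^ nat (int (k + j * m))))"
      by (rule admissible_at_eq[OF p g]) simp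
    finally show ?thesis by (simp only: nat_int)
  qed
  then have "(\<Sum>j<r. admissible_at p f a g (n + int (j * m))) = real (card {j \<in> {..<r}. admissible p f a (int g ^ (k + j * m))})"
    by (simp add: of_bool_def sum.If_cases Int_def)
  also have "\<dots> \<le> 3 / 4 * real r"
    using admissible_coset_bound[OF p r pm m bezout f1 f big g gm, of a k] by simp
  finally have "(\<Sum>j<r. admissible_at p f a g (n + int (j * m))) / real r \<le> 3 / 4"
    using r0 by (simp add: divide_le_eq)
  then show ?thesis unfolding coset_balanced_def n by linarith
qed

section \<open>Selection of primes\<close>

lemma largest_prime_divisor_prime:
  assumes "k \<ge> 2"
  shows "prime (largest_prime_divisor k)" "largest_prime_divisor k dvd k"
proof -
  have "finite {p. prime p \<and> p dvd k}"
    using assms by (intro finite_subset[OF _ finite_divisors_nat[of k]]) auto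
  moreover have "{p. prime p \<and> p dvd k} \<noteq> {}" using prime_factor_nat[of k] assms by auto
  ultimately have "Max {p. prime p \<and> p dvd k} \<in> {p. prime p \<and> p dvd k}" by (rule Max_in)
  then show "prime (largest_prime_divisor k)" "largest_prime_divisor k dvd k"
    using assms by (auto simp: largest_prime_divisor_def)
qed

lemma two_power_card_prime_factors_le:
  fixes n :: nat
  assumes "n > 0"
  shows "2 ^ card (prime_factors n) \<le> n"
proof -
  have "(\<Prod>p\<in>prime_factors n. 2::nat) \<le> (\<Prod>p\<in>prime_factors n. p ^ multiplicity p n)"
  proof (rule prod_mono)
    fix p assume p: "p \<in> prime_factors n"
    then have "p \<ge> 2" "multiplicity p n \<noteq> 0"
      by (auto simp: prime_ge_2_nat prime_factors_multiplicity)
    then have "p ^ 1 \<le> p ^ multiplicity p n" by (intro power_increasing) auto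
    then show "0 \<le> (2::nat) \<and> 2 \<le> p ^ multiplicity p n" using \<open>p \<ge> 2\<close> by simp
  qed
  then show ?thesis using prime_factorization_nat[OF assms] by simp
qed

text \<open>Bounds the number of primes modulo which \<open>g\<close> has order dividing
  \<open>i\<close>: each is at least 2 and their product is at most \<open>g^i\<close>.\<close>

lemma card_prime_factors_power_minus_one:
  fixes g :: nat
  assumes "g \<ge> 2" "i \<ge> 1"
  shows "real (card (prime_factors (g ^ i - 1))) \<le> real i * log 2 (real g)"
proof -
  have "1 < g ^ i" using assms by (intro one_less_power) auto
  then have "2 ^ card (prime_factors (g ^ i - 1)) \<le> g ^ i - 1"
    by (intro two_power_card_prime_factors_le) simp
  then have "2 ^ card (prime_factors (g ^ i - 1)) \<le> g ^ i" by simp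
  then have "real (2 ^ card (prime_factors (g ^ i - 1))) \<le> real (g ^ i)" by (simp only: of_nat_le_iff)
  then have "2 powr real (card (prime_factors (g ^ i - 1))) \<le> real g ^ i" by (simp add: powr_realpow)
  then have "real (card (prime_factors (g ^ i - 1))) \<le> log 2 (real g ^ i)"
    using assms(1) by (subst le_log_iff) auto
  also have "\<dots> = real i * log 2 (real g)" using assms by (simp add: log_nat_power)
  finally show ?thesis .
qed

text \<open>In terms of \<open>y = z / ln z ^ 2\<close>: the discarded primes are at most half of
  the supply (here \<open>2 - 2 * \<alpha> < 1\<close>), the remaining ones exceed any constant, and
  so does \<open>y powr (2 * \<alpha> - 1)\<close>, which will bound \<open>r / m\<close> from
  below.\<close>

lemma prime_selection_asymptotics:
  fixes \<alpha> c L D B :: real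
  assumes "1 / 2 < \<alpha>" "\<alpha> < 1" "c > 0"
  shows "eventually (\<lambda>z. z / ln z ^ 2 + L * z powr (2 - 2 * \<alpha>) \<le> c / 2 * (z / ln z)) at_top"
    "eventually (\<lambda>z. z / ln z ^ 2 > B) at_top"
    "eventually (\<lambda>z. (z / ln z ^ 2) powr (2 * \<alpha> - 1) > D) at_top"
  using assms by real_asymp+

text \<open>From the supply of primes up to \<open>z\<close>, those up to
  \<open>z / ln z ^ 2\<close> and those dividing some \<open>g^i - 1\<close> with \<open>i\<close>
  at most \<open>z powr (1 - \<alpha>)\<close> are discarded. For the others
  \<open>r \<ge> p powr \<alpha>\<close> forces \<open>m \<le> p powr (1 - \<alpha>)\<close>, so
  \<open>g^m = 1\<close> is excluded, and \<open>r / m\<close> is at least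
  \<open>p powr (2 * \<alpha> - 1)\<close>.\<close>

theorem prime_selection:
  fixes \<alpha> :: real and g :: nat and D B :: real
  assumes \<alpha>: "1 / 2 < \<alpha>" "\<alpha> < 1" and g: "g \<ge> 2"
    and dense: "(\<lambda>z::real. real (card {l::nat. real l \<le> z \<and> prime l \<and>
            real (largest_prime_divisor (l - 1)) \<ge> real l powr \<alpha>})) \<in> \<Omega>(\<lambda>z. z / ln z)"
  obtains c where "c > 0"
    "eventually (\<lambda>z. \<exists>A. finite A \<and> c * (z / ln z) \<le> real (card A) \<and> (\<forall>p\<in>A. prime p \<and> real p \<le> z \<and> real p > B \<and>
       (\<exists>m r. p = m * r + 1 \<and> prime r \<and> m \<ge> 1 \<and> (z / ln z ^ 2) powr \<alpha> \<le> real r \<and> D * real m < real r \<and>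
         \<not> [g ^ m = 1] (mod p)))) at_top"
proof -
  define good where "good z = {l::nat. real l \<le> z \<and> prime l \<and>
            real (largest_prime_divisor (l - 1)) \<ge> real l powr \<alpha>}" for z
  obtain c where c: "c > 0" and ev: "eventually (\<lambda>z. norm (real (card (good z))) \<ge> c * norm (z / ln z)) at_top"
    using dense unfolding good_def by (elim landau_omega.bigE)
  define L where "L = log 2 (real g)"
  define y where "y z = z / ln z ^ 2" for z :: real
  have L: "L \<ge> 0" using g by (simp add: L_def)
  note asy = prime_selection_asymptotics(1)[OF \<alpha> c, of L] prime_selection_asymptotics(2)[OF \<alpha> c, of "max B 3"]
    prime_selection_asymptotics(3)[OF \<alpha> c, of "max D 1"]
  note asy = asy[folded y_def]
  have "eventually (\<lambda>z. \<exists>A. finite A \<and> c / 2 * (z / ln z) \<le> real (card A) \<and> (\<forall>p\<in>A. prime p \<and> real p \<le> z \<and> real p > B \<and>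
       (\<exists>m r. p = m * r + 1 \<and> prime r \<and> m \<ge> 1 \<and> y z powr \<alpha> \<le> real r \<and> D * real m < real r \<and>
         \<not> [g ^ m = 1] (mod p)))) at_top"
    using ev asy eventually_gt_at_top[of 3]
  proof eventually_elim
    case (elim z)
    define Y where "Y = nat \<lfloor>z powr (1 - \<alpha>)\<rfloor>"
    define small where "small = {l \<in> good z. real l \<le> y z}"
    define bad where "bad = (\<Union>i\<in>{1..Y}. prime_factors (g ^ i - 1))"
    define A where "A = good z - small - bad"
    have "good z \<subseteq> {..nat \<lfloor>z\<rfloor>}" by (auto simp: good_def le_nat_floor)
    then have fin: "finite (good z)" by (rule finite_subset) simp
    have y0: "y z > 3" using elim by simp
    have "small \<subseteq> {1..nat \<lfloor>y z\<rfloor>}"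
      by (auto simp: small_def good_def le_nat_floor prime_gt_0_nat Suc_le_eq)
    then have "card small \<le> card {1..nat \<lfloor>y z\<rfloor>}" by (intro card_mono) auto
    also have "real \<dots> \<le> y z" using y0 by simp
    finally have small: "real (card small) \<le> y z" by simp
    have YL: "real Y \<le> z powr (1 - \<alpha>)" by (simp add: Y_def)
    have "real (card bad) \<le> real (\<Sum>i\<in>{1..Y}. card (prime_factors (g ^ i - 1)))"
      unfolding bad_def by (subst of_nat_le_iff) (rule card_UN_le, simp)
    also have "\<dots> \<le> (\<Sum>i\<in>{1..Y}. real Y * L)"
      unfolding of_nat_sum
    proof (rule sum_mono)
      fix i assume i: "i \<in> {1..Y}"
      have "real (card (prime_factors (g ^ i - 1))) \<le> real i * L"
        unfolding L_def using g i by (intro card_prime_factors_power_minus_one) auto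
      also have "\<dots> \<le> real Y * L" using i L by (intro mult_right_mono) auto
      finally show "real (card (prime_factors (g ^ i - 1))) \<le> real Y * L" .
    qed
    also have "\<dots> = L * (real Y * real Y)" by simp
    also have "\<dots> \<le> L * (z powr (1 - \<alpha>) * z powr (1 - \<alpha>))"
      using YL L by (intro mult_left_mono mult_mono) auto
    also have "\<dots> = L * z powr (2 - 2 * \<alpha>)" by (simp flip: powr_add)
    finally have bad: "real (card bad) \<le> L * z powr (2 - 2 * \<alpha>)" .
    have "card (good z) \<le> card (A \<union> (small \<union> bad))"
      using fin by (intro card_mono) (auto simp: A_def small_def bad_def)
    also have "\<dots> \<le> card A + (card small + card bad)"
      by (rule order_trans[OF card_Un_le add_left_mono[OF card_Un_le]])
    finally have "real (card (good z)) \<le> real (card A) + (real (card small) + real (card bad))" by linarith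
    moreover have "c * (z / ln z) \<le> real (card (good z))"
    proof -
      have "z / ln z \<ge> 0" using elim by simp
      then show ?thesis using elim(1) unfolding real_norm_def abs_of_nonneg[OF \<open>0 \<le> z / ln z\<close>] by simp
    qed
    ultimately have "c * (z / ln z) \<le> real (card A) + (y z + L * z powr (2 - 2 * \<alpha>))"
      using small bad by linarith
    moreover have "y z + L * z powr (2 - 2 * \<alpha>) \<le> c / 2 * (z / ln z)" using elim by simp
    ultimately have cardA: "c / 2 * (z / ln z) \<le> real (card A)" by simp
    have "prime p \<and> real p \<le> z \<and> real p > B \<and>
       (\<exists>m r. p = m * r + 1 \<and> prime r \<and> m \<ge> 1 \<and> y z powr \<alpha> \<le> real r \<and> D * real m < real r \<and>
         \<not> [g ^ m = 1] (mod p))" if pA: "p \<in> A" for p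
    proof -
      define r where "r = largest_prime_divisor (p - 1)"
      define m where "m = (p - 1) div r"
      have p: "prime p" "real p \<le> z" "real p > y z" "real r \<ge> real p powr \<alpha>" "p \<notin> bad"
        using pA by (auto simp: A_def small_def good_def r_def)
      have p3: "real p > 3" using p(3) y0 by simp
      have r: "prime r" "r dvd p - 1"
        using largest_prime_divisor_prime[of "p - 1"] p3 by (auto simp: r_def)
      have pm: "p = m * r + 1" using r(2) p3 by (simp add: m_def)
      have m1: "m \<ge> 1" using pm p3 by (cases m) auto
      have "real m * real p powr \<alpha> \<le> real m * real r" using p(4) by (intro mult_left_mono) auto
      also have "\<dots> \<le> real p" unfolding pm by simp
      also have "\<dots> = real p powr (1 - \<alpha>) * real p powr \<alpha>" using p3 by (simp flip: powr_add)
      finally have m: "real m \<le> real p powr (1 - \<alpha>)" using p3 by simp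
      have "D * real m \<le> max D 1 * real p powr (1 - \<alpha>)" using m by (intro mult_mono) auto
      also have "\<dots> < y z powr (2 * \<alpha> - 1) * real p powr (1 - \<alpha>)"
        using elim p3 by (intro mult_strict_right_mono) auto
      also have "\<dots> \<le> real p powr (2 * \<alpha> - 1) * real p powr (1 - \<alpha>)"
        using p(3) y0 \<alpha> by (intro mult_right_mono powr_mono2) auto
      also have "\<dots> = real p powr \<alpha>" by (simp flip: powr_add)
      also have "\<dots> \<le> real r" by (rule p(4))
      finally have Dm: "D * real m < real r" .
      have "\<not> [g ^ m = 1] (mod p)"
      proof
        assume "[g ^ m = 1] (mod p)"
        then have "p dvd g ^ m - 1" by (rule cong_to_1_nat)
        moreover have "1 < g ^ m" using g m1 by (intro one_less_power) auto
        ultimately have "p \<in> prime_factors (g ^ m - 1)" using p(1) by (simp add: in_prime_factors_iff)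
        moreover have "real p powr (1 - \<alpha>) \<le> z powr (1 - \<alpha>)"
          using p(2) \<alpha> by (intro powr_mono2) auto
        with m have "real m \<le> z powr (1 - \<alpha>)" by (rule order_trans)
        then have "m \<le> Y" by (simp add: Y_def le_nat_floor)
        ultimately show False using p(5) m1 by (auto simp: bad_def)
      qed
      moreover have "y z powr \<alpha> \<le> real p powr \<alpha>"
        using p(3) y0 \<alpha> by (intro powr_mono2) auto
      with p(4) have "y z powr \<alpha> \<le> real r" by linarith
      moreover have "real p > B" using elim p(3) by simp
      ultimately show ?thesis using p(1,2) pm r(1) m1 Dm by blast
    qed
    then show ?case using cardA fin by (intro exI[of _ A]) (auto simp: A_def)
  qed
  then show thesis using that[of "c / 2"] c unfolding y_def by simp
qed

section \<open>Square-free polynomials and quadratic fields\<close>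

lemma map_poly_of_int_mult:
  "map_poly of_int (a * b) = (map_poly of_int a * map_poly of_int b :: 'a::{comm_ring_1,ring_char_0} poly)"
  by (rule poly_eqI) (simp add: coeff_map_poly coeff_mult)

text \<open>A nonzero element of minimal degree in the ideal generated by two integer polynomials divides
  both up to constants, so it is constant if they have no common complex root.\<close>

lemma int_poly_bezout:
  fixes f h :: "int poly"
  assumes f: "f \<noteq> 0"
    and no_root: "\<And>x::complex. poly (map_poly of_int f) x = 0 \<Longrightarrow> poly (map_poly of_int h) x \<noteq> 0"
  shows "\<exists>U V R. R \<noteq> 0 \<and> U * f + V * h = [:R:]"
proof -
  define Id where "Id = {U * f + V * h | U V. True}"
  have f_Id: "f \<in> Id" unfolding Id_def by (rule CollectI, rule exI[of _ 1], rule exI[of _ 0]) simp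
  have h_Id: "h \<in> Id" unfolding Id_def by (rule CollectI, rule exI[of _ 0], rule exI[of _ 1]) simp
  obtain d where d: "d \<in> Id - {0}" and min: "\<And>y. y \<in> Id - {0} \<Longrightarrow> degree d \<le> degree y"
    using ex_has_least_nat[of "\<lambda>y. y \<in> Id - {0}" f degree] f f_Id by blast
  have lin: "[:k:] * a - d * q \<in> Id" if a: "a \<in> Id" for k a q
  proof -
    obtain U V U' V' where "a = U * f + V * h" "d = U' * f + V' * h" using a d by (auto simp: Id_def)
    then have "K * a - d * q = (K * U - U' * q) * f + (K * V - V' * q) * h" for K
      by (simp add: algebra_simps)
    then show ?thesis unfolding Id_def by blast
  qed
  have div: "\<exists>k q. k \<noteq> 0 \<and> [:k:] * a = d * q" if a: "a \<in> Id" for a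
  proof -
    obtain q t where qt: "pseudo_divmod a d = (q, t)" by (cases "pseudo_divmod a d")
    define k where "k = lead_coeff d ^ (Suc (degree a) - degree d)"
    have "[:k:] * a = d * q + t" and t: "t = 0 \<or> degree t < degree d"
      using pseudo_divmod[OF _ qt] d by (auto simp: k_def)
    then have "t = [:k:] * a - d * q" by simp
    then have "t \<in> Id" using lin[OF a] by simp
    then have "t = 0" using t min[of t] by force
    moreover have "k \<noteq> 0" using d by (simp add: k_def)
    ultimately show ?thesis using \<open>[:k:] * a = d * q + t\<close> by auto
  qed
  have "degree d = 0"
  proof (rule ccontr)
    assume deg: "degree d \<noteq> 0"
    have "\<not> constant (poly (map_poly of_int d :: complex poly))"
      using deg by (simp add: constant_degree degree_map_poly)
    then obtain x :: complex where x: "poly (map_poly of_int d) x = 0"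
      using fundamental_theorem_of_algebra by blast
    have root: "poly (map_poly of_int a) x = 0" if a: "a \<in> Id" for a
    proof -
      obtain k q where k: "k \<noteq> 0" and eq: "[:k:] * a = d * q" using div[OF a] by blast
      have "poly (map_poly of_int ([:k:] * a)) x = 0"
        unfolding eq using x by (simp add: map_poly_of_int_mult)
      then show ?thesis using k unfolding map_poly_of_int_mult by (simp add: map_poly_pCons)
    qed
    show False using no_root[OF root[OF f_Id]] root[OF h_Id] by blast
  qed
  then obtain R where R: "d = [:R:]" by (metis degree_eq_zeroE)
  then have "R \<noteq> 0" using d by auto
  moreover obtain U V where "d = U * f + V * h" using d by (auto simp: Id_def)
  ultimately show ?thesis using R by metis
qed

text \<open>The argument on cosets needs a nonzero constant term, so the power of \<open>X\<close>
  in \<open>f\<close> is split off. It is at most \<open>X\<close>, as 0 is not a multiple root; so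
  the degree stays positive, and \<open>f1\<close> inherits having no root in common with its
  derivative.\<close>

lemma squarefree_poly_decomposition:
  fixes f :: "int poly"
  assumes deg: "degree f \<ge> 3" and sf: "rsquarefree (map_poly of_int f :: complex poly)"
  obtains i f1 U V R where "f = monom 1 i * f1" "poly f1 0 \<noteq> 0" "degree f1 \<ge> 1"
    "U * f1 + V * pderiv f1 = [:R:]" "R \<noteq> 0"
proof -
  have hom': "map_poly of_int (pderiv a) = (pderiv (map_poly of_int a) :: complex poly)" for a :: "int poly"
    by (rule poly_eqI) (simp add: coeff_map_poly coeff_pderiv)
  have nz: "f \<noteq> 0" using deg by auto
  define i where "i = order 0 f"
  obtain f1 where f1: "f = [:-0, 1:] ^ i * f1" "\<not> [:-0, 1:] dvd f1"
    using order_decomp[OF nz, of 0] unfolding i_def by blast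
  have f: "f = monom 1 i * f1" using f1(1) by (simp add: monom_altdef)
  have f0: "poly f1 0 \<noteq> 0" using f1(2) by (simp add: poly_eq_0_iff_dvd)
  have sf': "\<not> (poly (map_poly of_int f) x = 0 \<and> poly (pderiv (map_poly of_int f)) x = 0)" for x :: complex
    using sf by (simp add: rsquarefree_roots)
  have "i \<le> 1"
  proof (rule ccontr)
    assume "\<not> i \<le> 1"
    then have "coeff f 0 = 0" "coeff f 1 = 0" by (simp_all add: f coeff_monom_mult)
    then show False using sf'[of 0] by (simp add: poly_0_coeff_0 coeff_map_poly coeff_pderiv)
  qed
  have "degree f = i + degree f1" using nz unfolding f by (subst degree_mult_eq) (auto simp: degree_monom_eq)
  then have "degree f1 \<ge> 1" using deg \<open>i \<le> 1\<close> by simp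
  moreover have "\<exists>U V R. R \<noteq> 0 \<and> U * f1 + V * pderiv f1 = [:R:]"
  proof (rule int_poly_bezout)
    show "f1 \<noteq> 0" using f0 by auto
    fix x :: complex assume "poly (map_poly of_int f1) x = 0"
    then show "poly (map_poly of_int (pderiv f1)) x \<noteq> 0"
      using sf'[of x] by (simp add: f map_poly_of_int_mult hom' pderiv_mult)
  qed
  ultimately show thesis using that f f0 by blast
qed

section \<open>From equal quadratic fields to squares\<close>

lemma int_square_of_rat_square:
  fixes q :: rat
  assumes "of_int k = q\<^sup>2"
  shows "\<exists>w. k = w\<^sup>2"
proof -
  obtain a b where ab: "quotient_of q = (a, b)" by (cases "quotient_of q")
  have q: "q = of_int a / of_int b" using ab by (rule quotient_of_div)
  have b: "b > 0" using ab by (rule quotient_of_denom_pos)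
  have "(of_int (k * b\<^sup>2) :: rat) = of_int (a\<^sup>2)"
    using assms b by (simp add: q power_divide field_simps)
  then have eq: "k * b\<^sup>2 = a\<^sup>2" by (simp only: of_int_eq_iff)
  have "coprime (b\<^sup>2) (a\<^sup>2)" using quotient_of_coprime[OF ab] by (simp add: coprime_commute)
  moreover have "b\<^sup>2 dvd a\<^sup>2" using eq by (metis dvd_triv_right)
  ultimately have "is_unit (b\<^sup>2)" by (metis coprime_absorb_left)
  then have "b\<^sup>2 = 1" by (simp add: power2_eq_1_iff)
  then show ?thesis using eq by auto
qed

abbreviation complex_ring :: "complex ring" where
  "complex_ring \<equiv> ring_of_type_algebra"

lemma a_inv_complex_ring: "\<ominus>\<^bsub>complex_ring\<^esub> x = - x"
proof -
  interpret R: field complex_ring by (rule field_from_type_algebra)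
  show ?thesis by (rule R.minus_equality) (auto simp: ring_of_type_algebra_def)
qed

lemma m_inv_complex_ring:
  assumes "x \<noteq> 0"
  shows "inv\<^bsub>complex_ring\<^esub> x = inverse x"
proof -
  interpret R: field complex_ring by (rule field_from_type_algebra)
  show ?thesis using assms by (intro R.comm_inv_char) (auto simp: ring_of_type_algebra_def)
qed

text \<open>Elements of this shape are closed under the field operations; inverses come from the
  conjugate \<open>h'\<close> and the norm \<open>n\<close>.\<close>

lemma rat_adjoin_sqrt_subset:
  assumes "h \<in> rat_adjoin_sqrt a"
  shows "\<exists>x y. h = of_rat x + of_rat y * csqrt (of_int a)"
  using assms unfolding rat_adjoin_sqrt_def
proof (induction rule: generate_field.induct)
  case one
  show ?case by (intro exI[of _ 1] exI[of _ 0]) (simp add: ring_of_type_algebra_def)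
next
  case (incl h)
  then consider "h \<in> \<rat>" | "h = csqrt (of_int a)" by blast
  then show ?case
  proof cases
    case 1
    then obtain x where "h = of_rat x" by (auto elim: Rats_cases)
    then show ?thesis by (intro exI[of _ x] exI[of _ 0]) simp
  next
    case 2
    then show ?thesis by (intro exI[of _ 0] exI[of _ 1]) simp
  qed
next
  case (a_inv h)
  then obtain x y where "h = of_rat x + of_rat y * csqrt (of_int a)" by blast
  then show ?case
    by (intro exI[of _ "- x"] exI[of _ "- y"]) (simp add: a_inv_complex_ring of_rat_minus)
next
  case (m_inv h)
  then obtain x y where h: "h = of_rat x + of_rat y * csqrt (of_int a)" by blast
  have h0: "h \<noteq> 0" using m_inv by (simp add: ring_of_type_algebra_def)
  define n where "n = x\<^sup>2 - y\<^sup>2 * of_int a"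
  define h' where "h' = of_rat x - of_rat y * csqrt (of_int a)"
  have sq: "(csqrt (of_int a))\<^sup>2 = of_rat (of_int a)" by (simp add: power2_csqrt)
  have "h * h' = (of_rat x)\<^sup>2 - (of_rat y)\<^sup>2 * (csqrt (of_int a))\<^sup>2"
    by (simp add: h h'_def power2_eq_square algebra_simps)
  then have hh: "h * h' = of_rat n"
    unfolding sq by (simp only: n_def of_rat_diff of_rat_mult of_rat_power)
  show ?case
  proof (cases "n = 0")
    case False
    then have "inverse h = h' / of_rat n"
      using h0 hh by (simp add: field_simps)
    also have "\<dots> = of_rat (x / n) + of_rat (- y / n) * csqrt (of_int a)"
      using False by (simp add: h'_def of_rat_divide of_rat_minus field_simps)
    finally show ?thesis unfolding m_inv_complex_ring[OF h0] by blast
  next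
    \<comment> \<open>A nonzero \<open>h\<close> has norm zero only if the adjoined root is
      rational; then the conjugate vanishes and \<open>h = 2 x\<close>.\<close>
    case True
    then have "h' = 0" using hh h0 by simp
    then have "h = of_rat (2 * x)" by (simp add: h h'_def of_rat_mult)
    then have "inverse h = of_rat (inverse (2 * x))" by (simp only: of_rat_inverse)
    then have "inverse h = of_rat (inverse (2 * x)) + of_rat 0 * csqrt (of_int a)" by simp
    then show ?thesis unfolding m_inv_complex_ring[OF h0] by blast
  qed
next
  case (eng_add h1 h2)
  then obtain x1 y1 x2 y2 where "h1 = of_rat x1 + of_rat y1 * csqrt (of_int a)"
    "h2 = of_rat x2 + of_rat y2 * csqrt (of_int a)" by blast
  then show ?case
    by (intro exI[of _ "x1 + x2"] exI[of _ "y1 + y2"])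
       (simp add: ring_of_type_algebra_def of_rat_add algebra_simps)
next
  case (eng_mult h1 h2)
  then obtain x1 y1 x2 y2 where h: "h1 = of_rat x1 + of_rat y1 * csqrt (of_int a)"
    "h2 = of_rat x2 + of_rat y2 * csqrt (of_int a)" by blast
  have "csqrt (of_int a) * csqrt (of_int a) = of_rat (of_int a)"
    using power2_csqrt[of "of_int a"] by (simp add: power2_eq_square)
  then have "h1 * h2 = of_rat (x1 * x2 + y1 * y2 * of_int a) + of_rat (x1 * y2 + x2 * y1) * csqrt (of_int a)"
    unfolding h of_rat_add of_rat_mult by (simp only: flip: \<open>_ = of_rat (of_int a)\<close>) (simp add: algebra_simps)
  then show ?case by (auto simp: ring_of_type_algebra_def)
qed

lemma csqrt_in_rat_adjoin_sqrt: "csqrt (of_int a) \<in> rat_adjoin_sqrt a"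
  unfolding rat_adjoin_sqrt_def by (rule generate_field.incl) simp

text \<open>Write the root of \<open>y\<close> as \<open>a + b\<close> times the root of
  \<open>s\<close> and square. If \<open>a = 0\<close>, then \<open>s y = (b s)^2\<close>. Otherwise
  both roots turn out to be rational, for \<open>b = 0\<close> through the reverse inclusion, and
  \<open>s\<close> and \<open>y\<close> are both squares.\<close>

lemma rat_adjoin_sqrt_eq_imp_square:
  assumes eq: "rat_adjoin_sqrt y = rat_adjoin_sqrt s"
  shows "\<exists>w. s * y = w\<^sup>2"
proof -
  have sq: "(csqrt (of_int a))\<^sup>2 = of_rat (of_int a)" for a :: int by (simp add: power2_csqrt)
  have int_sq: "\<exists>w. a = w\<^sup>2" if "csqrt (of_int a) = of_rat q" for a q
  proof (rule int_square_of_rat_square)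
    have "(of_rat (of_int a) :: complex) = of_rat (q\<^sup>2)"
      unfolding sq[symmetric] that by (simp add: of_rat_power)
    then show "of_int a = q\<^sup>2" by (simp only: of_rat_eq_iff)
  qed
  have rational: ?thesis if rt: "csqrt (of_int s) = of_rat q" "csqrt (of_int y) = of_rat q'" for q q'
  proof -
    obtain v w where "s = v\<^sup>2" "y = w\<^sup>2" using int_sq[OF rt(1)] int_sq[OF rt(2)] by auto
    then have "s * y = (v * w)\<^sup>2" by (simp add: power_mult_distrib)
    then show ?thesis by blast
  qed
  obtain a b where ab: "csqrt (of_int y) = of_rat a + of_rat b * csqrt (of_int s)"
    using rat_adjoin_sqrt_subset[of "csqrt (of_int y)" s] csqrt_in_rat_adjoin_sqrt[of y] eq by blast
  obtain c d where cd: "csqrt (of_int s) = of_rat c + of_rat d * csqrt (of_int y)"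
    using rat_adjoin_sqrt_subset[of "csqrt (of_int s)" y] csqrt_in_rat_adjoin_sqrt[of s] eq by blast
  have "(csqrt (of_int y))\<^sup>2 = (of_rat a)\<^sup>2 + (of_rat b)\<^sup>2 * (csqrt (of_int s))\<^sup>2 + 2 * of_rat a * of_rat b * csqrt (of_int s)"
    unfolding ab by (simp add: power2_eq_square algebra_simps)
  then have main: "of_rat (of_int y - a\<^sup>2 - b\<^sup>2 * of_int s) = of_rat (2 * a * b) * csqrt (of_int s)"
    unfolding sq by (simp only: of_rat_diff of_rat_mult of_rat_power) (simp add: algebra_simps)
  consider "b = 0" | "a = 0" | "a \<noteq> 0" "b \<noteq> 0" by blast
  then show ?thesis
  proof cases
    case 1
    then have y: "csqrt (of_int y) = of_rat a" using ab by simp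
    then have "csqrt (of_int s) = of_rat (c + d * a)" using cd by (simp add: of_rat_add of_rat_mult)
    then show ?thesis using y rational by blast
  next
    case 2
    have "(of_rat (of_int y - b\<^sup>2 * of_int s) :: complex) = of_rat 0" using main 2 by simp
    then have "of_int y - b\<^sup>2 * of_int s = 0" by (simp only: of_rat_eq_iff)
    then have "of_int (s * y) = (b * of_int s)\<^sup>2" by (simp add: power2_eq_square algebra_simps)
    then show ?thesis by (rule int_square_of_rat_square)
  next
    case 3
    then have "csqrt (of_int s) = of_rat ((of_int y - a\<^sup>2 - b\<^sup>2 * of_int s) / (2 * a * b))"
      using main by (simp add: of_rat_divide field_simps)
    then obtain q where q: "csqrt (of_int s) = of_rat q" by blast
    then have "csqrt (of_int y) = of_rat (a + b * q)" using ab by (simp add: of_rat_add of_rat_mult)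
    then show ?thesis using q rational by blast
  qed
qed

section \<open>The bound for the number of equal fields\<close>

text \<open>The case of \<open>coset_sieve\<close> in which the functions are the balanced
  indicators of admissibility, of period \<open>p - 1\<close>. The lower bound on \<open>p\<close>
  keeps it from dividing 2, \<open>g\<close>, \<open>K\<close> and the leading and constant
  coefficients of \<open>f1\<close>.\<close>

theorem square_class_sieve:
  fixes f f1 :: "int poly" and g :: nat and A :: "nat set"
  assumes f: "f = monom 1 i * f1" "poly f1 0 \<noteq> 0" "degree f1 \<ge> 1"
    and bezout: "U * f1 + V * pderiv f1 = [:K:]" "K \<noteq> 0"
    and A: "finite A" and R: "R > 0" and z: "z \<ge> 0"
    and sel: "\<And>p. p \<in> A \<Longrightarrow> prime p \<and> real p \<le> z \<and>
       real p > real_of_int (\<bar>lead_coeff f1\<bar> + \<bar>poly f1 0\<bar> + \<bar>K\<bar>) + real g + 2 \<and>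
       (\<exists>m r. p = m * r + 1 \<and> prime r \<and> m \<ge> 1 \<and> R \<le> real r \<and> real (33 * (degree f1)\<^sup>2) * real m < real r \<and>
         \<not> [g ^ m = 1] (mod p))"
    and g: "g \<ge> 1" and s: "squarefree s"
    and S: "S \<subseteq> {n. int n \<in> {M + 1..M + int N} \<and> (\<exists>w. s * poly f (int g ^ n) = w\<^sup>2)}"
  shows "real (card S) * (real (card A) / 4)\<^sup>2 * real N ^ k
    \<le> (real (card A))\<^sup>2 * (z\<^sup>2) ^ Suc k + real (card A) * (z / R) * (2 * real N) ^ Suc k"
proof -
  have "\<exists>m r. \<forall>p\<in>A. p = m p * r p + 1 \<and> prime (r p) \<and> m p \<ge> 1 \<and> R \<le> real (r p) \<and>
      real (33 * (degree f1)\<^sup>2) * real (m p) < real (r p) \<and> \<not> [g ^ m p = 1] (mod p)"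
    using sel by metis
  then obtain m r where mr: "\<And>p. p \<in> A \<Longrightarrow> p = m p * r p + 1 \<and> prime (r p) \<and> m p \<ge> 1 \<and> R \<le> real (r p) \<and>
      real (33 * (degree f1)\<^sup>2) * real (m p) < real (r p) \<and> \<not> [g ^ m p = 1] (mod p)" by blast
  define a where "a p = s ^ ((p - 1) div 2)" for p :: nat
  define H where "H p = coset_balanced (m p) (r p) (admissible_at p f (a p) g)" for p
  define zn where "zn = nat \<lfloor>z\<rfloor>"
  have zn: "real zn \<le> z" using z by (simp add: zn_def)
  have per: "admissible_at p f (a p) g (n + int (m p * r p)) = admissible_at p f (a p) g n" if "p \<in> A" for p n
  proof -
    have "p - 1 = m p * r p" using mr[OF that] by linarith
    then show ?thesis using admissible_at_periodic[of p f "a p" g n] by simp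
  qed
  have "real (card (int ` S)) * (real (card A) / 4)\<^sup>2 * real N ^ k
      \<le> (real (card A))\<^sup>2 * (real zn ^ 2) ^ Suc k + real (card A) * (real zn / R) * (2 * real N) ^ Suc k"
  proof (rule coset_sieve[where H = H and m = m and r = r and M = M])
    show "finite A" by (rule A)
    show "R > 0" by (rule R)
    show "int ` S \<subseteq> {M + 1..M + int N}" using S by auto
    show "inj_on (\<lambda>p. m p * r p) A"
      by (rule inj_onI) (metis mr)
    fix p assume p: "p \<in> A"
    note mrp = mr[OF p]
    show rp: "prime (r p)" "R \<le> real (r p)" using mrp by auto
    show "H p (n + int (m p * r p)) = H p n" for n
      unfolding H_def by (rule coset_balanced_periodic) (rule per[OF p])
    show "(\<Sum>j<r p. H p (n + int (j * m p))) = 0" for n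
      unfolding H_def using prime_gt_0_nat[OF rp(1)] by (intro coset_balanced_sum per[OF p])
    show "\<bar>H p n\<bar> \<le> 1" for n
      unfolding H_def by (rule coset_balanced_abs_le) (simp add: admissible_at_def)
    have "p \<le> zn" using sel[OF p] by (simp add: zn_def le_nat_floor)
    then show "0 < m p * r p \<and> m p * r p \<le> zn" using mrp prime_gt_0_nat[OF rp(1)] by auto
    fix n assume "n \<in> int ` S"
    then obtain k w where n: "n = int k" and kw: "s * poly f (int g ^ k) = w\<^sup>2" using S by auto
    have pp: "prime p" using sel[OF p] by blast
    have p_large: "\<not> int p dvd y" if "y \<noteq> 0" "\<bar>y\<bar> \<le> \<bar>lead_coeff f1\<bar> + \<bar>poly f1 0\<bar> + \<bar>K\<bar> + int g + 2" for y
    proof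
      assume "int p dvd y"
      then have "int p \<le> \<bar>y\<bar>" using \<open>y \<noteq> 0\<close> by (intro zdvd_imp_le) auto
      then have "real_of_int (int p) \<le> real_of_int (\<bar>lead_coeff f1\<bar> + \<bar>poly f1 0\<bar> + \<bar>K\<bar> + int g + 2)"
        using that(2) by (simp only: of_int_le_iff)
      then show False using sel[OF p] by simp
    qed
    have f1_nz: "lead_coeff f1 \<noteq> 0" using f(2) by auto
    have "\<not> int p dvd 2" by (rule p_large) auto
    then have odd_p: "odd p" using pp by (metis int_dvd_int_iff of_nat_numeral primes_dvd_imp_eq two_is_prime_nat dvd_refl)
    have big: "33 * (degree f1)\<^sup>2 * m p < r p"
      using mrp by (metis of_nat_less_iff of_nat_mult)
    \<comment> \<open>The size of \<open>r p\<close> makes it an odd prime; as \<open>p - 1\<close>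
      is even, the cofactor \<open>m p\<close> is even.\<close>
    have "33 * 1 * 1 \<le> 33 * (degree f1)\<^sup>2 * m p" using f(3) mrp by (intro mult_le_mono) auto
    then have "r p > 2" using big by linarith
    then have "odd (r p)" using rp(1) by (simp add: prime_odd_nat)
    moreover have "even (m p * r p)" using odd_p mrp by (metis even_plus_one_iff)
    ultimately have even_m: "even (m p)" by simp
    have ng: "\<not> p dvd g"
      using p_large[of "int g"] g by simp
    have "admissible p f (a p) (int g ^ k)"
      unfolding admissible_def a_def
      using squarefree_times_square_residue[OF pp _ s kw, of "(p - 1) div 2"] odd_p by auto
    then have "admissible_at p f (a p) g n = 1"
      unfolding n using admissible_at_eq[OF pp ng, of "int k"] by simp
    then show "1 / 4 \<le> H p n"
      unfolding H_def using mrp even_m f1_nz f bezout ng big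
      by (intro admissible_at_balanced[OF pp rp(1) _ _ _ bezout(1) _ _ f(3) _ f(1)] p_large) auto
  qed
  also have "\<dots> \<le> (real (card A))\<^sup>2 * (z\<^sup>2) ^ Suc k + real (card A) * (z / R) * (2 * real N) ^ Suc k"
    using zn R by (intro add_mono mult_left_mono mult_right_mono power_mono divide_right_mono) auto
  finally show ?thesis by (simp add: card_image)
qed

section \<open>Choice of parameters and uniformity\<close>

text \<open>The inequality \<open>1 - \<alpha> / 2 < 1 / (2 * \<alpha>)\<close> amounts to
  \<open>(1 - \<alpha>)^2 > 0\<close>, which leaves room for some \<open>\<tau> < 1 / 2\<close>.
  Then \<open>k\<close> is taken so large that \<open>z = N^\<tau>\<close> satisfies
  \<open>z^(2 (k + 1)) \<le> N^k\<close>.\<close>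

lemma sieve_exponents:
  fixes \<alpha> :: real
  assumes "1 / 2 < \<alpha>" "\<alpha> < 1"
  obtains \<tau> and k :: nat where "0 < \<tau>" "\<alpha> * \<tau> < 1" "1 - \<alpha> * \<tau> < 1 / (2 * \<alpha>)" "2 * \<tau> * real (Suc k) \<le> real k"
proof -
  have "(1 - \<alpha>)\<^sup>2 > 0" using assms by simp
  then have "(1 - 1 / (2 * \<alpha>)) / \<alpha> < 1 / 2"
    using assms by (simp add: field_simps power2_eq_square)
  then obtain \<tau> where \<tau>: "(1 - 1 / (2 * \<alpha>)) / \<alpha> < \<tau>" "\<tau> < 1 / 2" using dense by blast
  have "0 < (1 - 1 / (2 * \<alpha>)) / \<alpha>" using assms by (intro divide_pos_pos) (auto simp: field_simps)
  then have "0 < \<tau>" using \<tau> by linarith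
  moreover have "\<alpha> * \<tau> < 1 * 1" using \<open>0 < \<tau>\<close> \<tau>(2) assms by (intro mult_strict_mono) auto
  then have "\<alpha> * \<tau> < 1" by simp
  moreover have "1 - \<alpha> * \<tau> < 1 / (2 * \<alpha>)" using \<tau>(1) assms by (simp add: divide_less_eq mult.commute)
  moreover obtain k :: nat where "2 * \<tau> / (1 - 2 * \<tau>) \<le> real k" using real_arch_simple by blast
  then have "2 * \<tau> * real (Suc k) \<le> real k" using \<tau>(2) by (simp add: divide_le_eq algebra_simps)
  ultimately show thesis using that by blast
qed

text \<open>The second summand is \<open>x powr (1 - \<alpha> * \<tau>)\<close> times powers of the
  logarithm; the strict gap below \<open>\<beta>\<close> absorbs these for any
  \<open>\<gamma>\<close>.\<close>

lemma sieve_bound_asymptotics: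
  fixes \<alpha> \<beta> \<gamma> \<tau> C :: real
  assumes \<tau>: "0 < \<tau>" and \<alpha>: "\<alpha> > 0" "\<alpha> * \<tau> < 1" and \<beta>: "1 - \<alpha> * \<tau> < \<beta>" and C: "C > 0"
  shows "eventually (\<lambda>x. 16 + C * x * ln (x powr \<tau>) / (x powr \<tau> / ln (x powr \<tau>) ^ 2) powr \<alpha>
    \<le> x powr \<beta> * ln x powr \<gamma>) at_top"
proof -
  define e where "e = 1 - \<alpha> * \<tau>"
  have "0 < e" "e < \<beta>" using \<alpha> \<beta> by (simp_all add: e_def)
  then have "eventually (\<lambda>x. 16 + C * x powr e * ((\<tau> * ln x) * (\<tau> * ln x) powr (2 * \<alpha>))
    \<le> x powr \<beta> * ln x powr \<gamma>) at_top"
    using \<tau> \<alpha>(1) C by real_asymp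
  then show ?thesis using eventually_gt_at_top[of 1]
  proof eventually_elim
    case (elim x)
    define w where "w = \<tau> * ln x"
    have w: "w > 0" using \<tau> elim by (simp add: w_def)
    have "(x powr \<tau> / w ^ 2) powr \<alpha> = x powr (\<alpha> * \<tau>) / w powr (2 * \<alpha>)"
      using w elim by (simp add: powr_divide powr_powr mult.commute flip: powr_numeral)
    then have "x * w / (x powr \<tau> / w ^ 2) powr \<alpha> = (x / x powr (\<alpha> * \<tau>)) * (w * w powr (2 * \<alpha>))"
      by simp
    also have "x / x powr (\<alpha> * \<tau>) = x powr e"
      using elim by (simp add: e_def powr_diff)
    finally have "C * (x * w / (x powr \<tau> / w ^ 2) powr \<alpha>) = C * (x powr e * (w * w powr (2 * \<alpha>)))"
      by simp
    moreover have "ln (x powr \<tau>) = w" using elim by (simp add: w_def ln_powr)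
    ultimately show ?case using elim(1) by (simp add: w_def mult.assoc)
  qed
qed

lemma Q_count_le: "real (Q_count u M N s) \<le> real (nat N)"
proof -
  have "Q_count u M N s \<le> card (nat ` {M + 1..M + N})"
    unfolding Q_count_def by (rule card_mono) (auto intro!: image_eqI[of _ nat "int _"])
  also have "\<dots> \<le> card {M + 1..M + N}" by (rule card_image_le) simp
  finally show ?thesis by simp
qed

text \<open>Only finitely many \<open>N\<close> escape the eventual bound, and for each the trivial
  bound is independent of \<open>M\<close> and \<open>s\<close>; the constant adds up the resulting
  ratios.\<close>

lemma uniform_constant:
  fixes Q :: "int \<Rightarrow> int \<Rightarrow> int \<Rightarrow> nat" and h :: "real \<Rightarrow> real"
  assumes trivial: "\<And>M N s. real (Q M N s) \<le> real (nat N)"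
    and pos: "\<And>x. x \<ge> 2 \<Longrightarrow> h x > 0"
    and large: "eventually (\<lambda>x. \<forall>M N s. real_of_int N = x \<longrightarrow> squarefree s \<longrightarrow> real (Q M N s) \<le> h x) at_top"
  shows "\<exists>C>0. \<forall>M N s. N \<ge> 2 \<longrightarrow> squarefree s \<longrightarrow> real (Q M N s) \<le> C * h (real_of_int N)"
proof -
  obtain x0 where x0: "\<forall>x\<ge>x0. \<forall>M N s. real_of_int N = x \<longrightarrow> squarefree s \<longrightarrow> real (Q M N s) \<le> h x"
    using large unfolding eventually_at_top_linorder by blast
  define t where "t N = real_of_int N / h (real_of_int N)" for N
  define C where "C = 1 + (\<Sum>N\<in>{2..\<lceil>x0\<rceil>}. t N)"
  have t: "t N \<ge> 0" if "N \<ge> 2" for N using that pos[of "real_of_int N"] by (simp add: t_def)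
  have "0 \<le> (\<Sum>N\<in>{2..\<lceil>x0\<rceil>}. t N)" using t by (intro sum_nonneg) auto
  then have C1: "C \<ge> 1" by (simp add: C_def)
  have "real (Q M N s) \<le> C * h (real_of_int N)" if N: "N \<ge> 2" and s: "squarefree s" for M N s
  proof (cases "real_of_int N \<ge> x0")
    case True
    then have "real (Q M N s) \<le> 1 * h (real_of_int N)" using x0 s by simp
    also have "\<dots> \<le> C * h (real_of_int N)" using C1 pos[of "real_of_int N"] N by (intro mult_right_mono) auto
    finally show ?thesis .
  next
    case False
    then have "N \<in> {2..\<lceil>x0\<rceil>}" using N by (auto simp: le_ceiling_iff)
    then have "t N \<le> (\<Sum>N\<in>{2..\<lceil>x0\<rceil>}. t N)" using t by (intro member_le_sum) auto
    then have "t N \<le> C" by (simp add: C_def)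
    have "real (Q M N s) \<le> real_of_int N" using trivial[of M N s] N by simp
    also have "\<dots> = t N * h (real_of_int N)" using pos[of "real_of_int N"] N by (simp add: t_def)
    also have "\<dots> \<le> C * h (real_of_int N)"
      using \<open>t N \<le> C\<close> pos[of "real_of_int N"] N by (intro mult_right_mono) auto
    finally show ?thesis .
  qed
  then show ?thesis using C1 by (intro exI[of _ C]) auto
qed

lemma largest_prime_divisor_le:
  assumes "k \<ge> 1"
  shows "largest_prime_divisor k \<le> k"
proof (cases "k \<ge> 2")
  case True
  then show ?thesis using largest_prime_divisor_prime[of k] by (intro dvd_imp_le) auto
qed (use assms in \<open>simp add: largest_prime_divisor_def\<close>)

text \<open>A prime divisor of \<open>l - 1\<close> is smaller than \<open>l\<close>, so for
  \<open>\<alpha> \<ge> 1\<close> the set is empty; at \<open>l = 2\<close> the conventional value 1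
  is also below \<open>l\<close>.\<close>

lemma density_exponent_less_one:
  fixes \<alpha> :: real
  assumes dense: "(\<lambda>z::real. real (card {l::nat. real l \<le> z \<and> prime l \<and>
            real (largest_prime_divisor (l - 1)) \<ge> real l powr \<alpha>})) \<in> \<Omega>(\<lambda>z. z / ln z)"
  shows "\<alpha> < 1"
proof (rule ccontr)
  assume \<alpha>: "\<not> \<alpha> < 1"
  have empty: "{l::nat. real l \<le> z \<and> prime l \<and> real (largest_prime_divisor (l - 1)) \<ge> real l powr \<alpha>} = {}" for z
  proof -
    have "real (largest_prime_divisor (l - 1)) < real l powr \<alpha>" if "prime l" for l
    proof -
      have l: "l \<ge> 2" using that by (rule prime_ge_2_nat)
      have "largest_prime_divisor (l - 1) \<le> l - 1" using l by (intro largest_prime_divisor_le) simp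
      then have "real (largest_prime_divisor (l - 1)) < real l powr 1" using l by simp
      also have "\<dots> \<le> real l powr \<alpha>" using l \<alpha> by (intro powr_mono) auto
      finally show ?thesis .
    qed
    then show ?thesis by (auto simp: not_le)
  qed
  obtain c where "c > 0" and ev: "eventually (\<lambda>z. norm (0::real) \<ge> c * norm (z / ln z :: real)) at_top"
    using dense unfolding empty by (elim landau_omega.bigE) simp
  have "eventually (\<lambda>z::real. False) at_top"
    using ev eventually_gt_at_top[of 1]
  proof eventually_elim
    case (elim z)
    then have "c * norm (z / ln z) > 0" using \<open>c > 0\<close> by (intro mult_pos_pos) auto
    then show False using elim(1) unfolding norm_zero by linarith
  qed
  then show False by simp
qed

theorem theorem1p1:
  fixes g :: int and f :: "int poly" and u :: "nat \<Rightarrow> int" and \<alpha> \<beta> \<gamma> :: real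
  assumes "g > 1"
    and "Polynomial.degree f \<ge> 3"
    and "Polynomial.lead_coeff f > 0"
    and "rsquarefree (map_poly of_int f :: complex poly)"
    and "\<And>n. n \<ge> 1 \<Longrightarrow> u n = poly f (g ^ n)"
    and "\<alpha> > 0"
    and "(\<lambda>z::real. real (card {l::nat. real l \<le> z \<and> Factorial_Ring.prime l \<and>
            real (largest_prime_divisor (l - 1)) \<ge> real l powr \<alpha>})) \<in> \<Omega>(\<lambda>z. z / ln z)"
    and "\<beta> = 1 / (2 * \<alpha>)"
    and "\<gamma> = 2 - 1 / \<alpha>"
  shows "\<exists>C>0. \<forall>M N s :: int. N \<ge> 2 \<longrightarrow> squarefree s \<longrightarrow>
           real (Q_count u M N s) \<le> C * (real_of_int N powr \<beta> * ln (real_of_int N) powr \<gamma>)"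
proof -
  define h where "h x = x powr \<beta> * ln x powr \<gamma>" for x :: real
  have h_pos: "h x > 0" if "x \<ge> 2" for x using that by (simp add: h_def)
  have "eventually (\<lambda>x. \<forall>M N s. real_of_int N = x \<longrightarrow> squarefree s \<longrightarrow> real (Q_count u M N s) \<le> h x) at_top"
  proof (cases "\<alpha> \<le> 1 / 2")
    \<comment> \<open>Here \<open>\<beta> \<ge> 1\<close> and the trivial bound suffices; at
      \<open>\<alpha> = 1 / 2\<close> the exponents are exactly 1 and 0.\<close>
    case True
    have "eventually (\<lambda>x. x \<le> h x) at_top"
    proof (cases "\<alpha> = 1 / 2")
      case True
      show ?thesis using eventually_gt_at_top[of 1]
        by eventually_elim (simp add: h_def assms(8,9) True)
    next
      case False
      then have "\<beta> > 1" using \<open>\<alpha> \<le> 1 / 2\<close> \<open>\<alpha> > 0\<close> by (simp add: assms(8) field_simps)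
      then show ?thesis unfolding h_def by real_asymp
    qed
    then show ?thesis using eventually_ge_at_top[of 0]
    proof eventually_elim
      case (elim x)
      have "real (Q_count u M N s) \<le> h x" if "real_of_int N = x" for M N s
        using Q_count_le[of u M N s] elim that by auto
      then show ?case by blast
    qed
  next
    case False
    have \<alpha>: "1 / 2 < \<alpha>" "\<alpha> < 1" using False density_exponent_less_one[OF assms(7)] by auto
    define G where "G = nat g"
    have G: "G \<ge> 2" "int G = g" using assms(1) by (auto simp: G_def)
    obtain i f1 U V K where f: "f = monom 1 i * f1" "poly f1 0 \<noteq> 0" "degree f1 \<ge> 1"
      and bezout: "U * f1 + V * pderiv f1 = [:K:]" "K \<noteq> 0"
      using squarefree_poly_decomposition[OF assms(2,4)] by metis
    define B where "B = real_of_int (\<bar>lead_coeff f1\<bar> + \<bar>poly f1 0\<bar> + \<bar>K\<bar>) + real G + 2"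
    define D where "D = real (33 * (degree f1)\<^sup>2)"
    obtain \<tau> k where \<tau>: "0 < \<tau>" "\<alpha> * \<tau> < 1" "1 - \<alpha> * \<tau> < 1 / (2 * \<alpha>)" "2 * \<tau> * real (Suc k) \<le> real k"
      by (rule sieve_exponents[OF \<alpha>]) (rule that)
    obtain c where c: "c > 0" and
      sel: "eventually (\<lambda>z. \<exists>A. finite A \<and> c * (z / ln z) \<le> real (card A) \<and> (\<forall>p\<in>A. prime p \<and> real p \<le> z \<and> real p > B \<and>
       (\<exists>m r. p = m * r + 1 \<and> prime r \<and> m \<ge> 1 \<and> (z / ln z ^ 2) powr \<alpha> \<le> real r \<and> D * real m < real r \<and>
         \<not> [G ^ m = 1] (mod p)))) at_top"
      by (rule prime_selection[OF \<alpha> G(1) assms(7), of B D]) (rule that)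
    have lim: "filterlim (\<lambda>x. x powr \<tau>) at_top at_top" using \<tau>(1) by real_asymp
    \<comment> \<open>The 16 undoes the square of 1/4, the power of 2 comes from windows of length
      \<open>2 * N\<close>, and \<open>c\<close> from the density of the selected primes.\<close>
    define C where "C = 16 * 2 ^ Suc k / c"
    have asy: "eventually (\<lambda>x. 16 + C * x * ln (x powr \<tau>) / (x powr \<tau> / ln (x powr \<tau>) ^ 2) powr \<alpha> \<le> h x) at_top"
      unfolding h_def using \<tau> \<open>\<alpha> > 0\<close> c by (intro sieve_bound_asymptotics) (auto simp: C_def assms(8))
    show ?thesis
      using eventually_compose_filterlim[OF sel lim] asy eventually_gt_at_top[of 1]
        eventually_compose_filterlim[OF eventually_gt_at_top[of 1] lim]
    proof eventually_elim
      case (elim x)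
      define z where "z = x powr \<tau>"
      define R where "R = (z / ln z ^ 2) powr \<alpha>"
      have z1: "z > 1" using elim by (simp add: z_def)
      have R0: "R > 0" using z1 by (simp add: R_def)
      obtain A where A: "finite A" "c * (z / ln z) \<le> real (card A)" and
        selA: "\<And>p. p \<in> A \<Longrightarrow> prime p \<and> real p \<le> z \<and> real p > B \<and>
       (\<exists>m r. p = m * r + 1 \<and> prime r \<and> m \<ge> 1 \<and> R \<le> real r \<and> D * real m < real r \<and>
         \<not> [G ^ m = 1] (mod p))"
        using elim(1) unfolding z_def R_def by blast
      have czl: "c * (z / ln z) > 0" using c z1 by (intro mult_pos_pos) auto
      define b where "b = real (card A)"
      have b0: "b > 0" using czl A(2) by (simp add: b_def)
      have "real (Q_count u M N s) \<le> h x" if N: "real_of_int N = x" and s: "squarefree s" for M N s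
      proof -
        define n where "n = nat N"
        have n: "int n = N" "real n = x" using N elim by (auto simp: n_def)
        define S where "S = {n::nat. n \<ge> 1 \<and> int n \<in> {M + 1..M + N} \<and> rat_adjoin_sqrt (u n) = rat_adjoin_sqrt s}"
        have "S \<subseteq> {n. int n \<in> {M + 1..M + N} \<and> (\<exists>w. s * poly f (g ^ n) = w\<^sup>2)}"
          using rat_adjoin_sqrt_eq_imp_square assms(5) by (auto simp: S_def)
        then have "real (card S) * (real (card A) / 4)\<^sup>2 * real n ^ k
            \<le> (real (card A))\<^sup>2 * (z\<^sup>2) ^ Suc k + real (card A) * (z / R) * (2 * real n) ^ Suc k"
          using z1 G selA
          by (intro square_class_sieve[OF f bezout A(1) R0 _ _ _ s, of z G S M n k])
             (auto simp: n B_def D_def)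
        then have main: "real (card S) * (b / 4)\<^sup>2 * x ^ k
            \<le> b\<^sup>2 * (z\<^sup>2) ^ Suc k + b * (z / R) * (2 * x) ^ Suc k"
          by (simp only: n(2) b_def)
        have xk: "x ^ k > 0" using elim by simp
        \<comment> \<open>By the choice of \<open>k\<close>, the pairs with mean zero contribute
          only a constant after division by \<open>x ^ k\<close>.\<close>
        have zx: "(z\<^sup>2) ^ Suc k \<le> x ^ k"
        proof -
          have "(z\<^sup>2) ^ Suc k = z ^ (2 * Suc k)" by (simp only: power_mult)
          also have "\<dots> = z powr real (2 * Suc k)"
            by (rule powr_realpow[symmetric]) (use z1 in simp)
          also have "\<dots> = x powr (2 * \<tau> * real (Suc k))"
            unfolding z_def powr_powr by (simp add: algebra_simps)
          also have "\<dots> \<le> x powr real k" using \<tau>(4) elim by (intro powr_mono) auto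
          finally show ?thesis using elim by (simp add: powr_realpow)
        qed
        have zb: "b\<^sup>2 * (z\<^sup>2) ^ Suc k \<le> b\<^sup>2 * x ^ k" using zx by (intro mult_left_mono) auto
        have "real (card S) * (b\<^sup>2 * x ^ k) = 16 * (real (card S) * (b / 4)\<^sup>2 * x ^ k)"
          by (simp add: power2_eq_square)
        also have "\<dots> \<le> 16 * (b\<^sup>2 * x ^ k + b * (z / R) * (2 * x) ^ Suc k)"
          by (intro mult_left_mono order_trans[OF main add_right_mono[OF zb]]) simp
        also have "\<dots> = (16 + 16 * 2 ^ Suc k * x * (z / (b * R))) * (b\<^sup>2 * x ^ k)"
        proof -
          have "16 * (y * w + (q * y) * (v * x * w)) = (16 + 16 * v * x * q) * (y * w)" for y w q v :: real
            by (simp add: algebra_simps)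
          moreover have "b * (z / R) = z / (b * R) * b\<^sup>2" using b0 by (simp add: power2_eq_square)
          moreover have "(2 * x) ^ Suc k = 2 ^ Suc k * x * x ^ k" by (simp add: power_mult_distrib)
          ultimately show ?thesis by (simp only:)
        qed
        finally have "real (card S) \<le> 16 + 16 * 2 ^ Suc k * x * (z / (b * R))"
          using b0 xk by (simp add: mult_le_cancel_right)
        \<comment> \<open>There are at least \<open>c * (z / ln z)\<close> primes, so
          \<open>z / b\<close> costs only a logarithm.\<close>
        also have "z / (b * R) \<le> z / (c * (z / ln z) * R)"
          using A(2) c czl R0 z1 b0 by (intro divide_left_mono mult_right_mono mult_pos_pos) (auto simp: b_def)
        then have "16 + 16 * 2 ^ Suc k * x * (z / (b * R)) \<le> 16 + 16 * 2 ^ Suc k * x * (z / (c * (z / ln z) * R))"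
          using elim by (intro add_left_mono mult_left_mono) auto
        also have "\<dots> = 16 + C * x * ln z / R"
          using z1 c R0 by (simp add: C_def field_simps)
        also have "\<dots> \<le> h x" using elim(2) by (simp add: z_def R_def)
        finally show ?thesis by (simp add: Q_count_def S_def)
      qed
      then show ?case by blast
    qed
  qed
  then show ?thesis
    using uniform_constant[of "Q_count u" h] Q_count_le h_pos unfolding h_def by blast
qed

end
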